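(* Fix $\varepsilon>0$ and let $\alpha=\alpha(n)$ satisfy $\alpha(n)\to 0$ as $n\to\infty$. For each $n$, let $G_\alpha$ be any graph on the vertex set $[n]=\{1,\dots,n\}$ with minimum degree $\delta(G_\alpha)\ge \alpha n$. If $$p=p(n)\ge (1+\varepsilon)\frac{\log(1/\alpha)}{n},$$ then $$\Pr\big(G_\alpha\cup G(n,p)\text{ is Hamiltonian}\big)\to 1 \quad\text{as } n\to\infty.$$
   Context: $G(n,p)$ denotes the binomial random graph on vertex set $[n]$ in which each of the $\binom n2$ possible edges is present independently with probability $p$. The union $G_\alpha\cup G(n,p)$ is the graph on $[n]$ whose edge set is the union of the edge sets. A graph is Hamiltonian if it contains a cycle passing through every vertex exactly once. Logarithms are natural. *)

theory Defs
  imports "HOL-Probability.Probability"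
begin

text \<open>
  A finite simple graph is given by its vertex set \<open>V\<close> and its edge set \<open>E\<close>, where edges are
  two-element subsets of \<open>V\<close>.
\<close>

definition all_edges :: "'a set \<Rightarrow> 'a set set" where
  "all_edges V = {e. e \<subseteq> V \<and> card e = 2}"

definition simple_graph :: "'a set \<Rightarrow> 'a set set \<Rightarrow> bool" where
  "simple_graph V E \<longleftrightarrow> finite V \<and> E \<subseteq> all_edges V"

definition degree :: "'a set set \<Rightarrow> 'a \<Rightarrow> nat" where
  "degree E v = card {e \<in> E. v \<in> e}"

text \<open>Only meaningful for a finite nonempty vertex set, because of \<open>Min\<close>.\<close>

definition min_degree :: "'a set \<Rightarrow> 'a set set \<Rightarrow> nat" where
  "min_degree V E = Min (degree E ` V)"

text \<open>
  A cycle is the cyclic sequence \<open>vs\<close> of its vertices, without repetition; it has length at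
  least 3 (so that, e.g., a single edge is not a cycle).
\<close>

definition is_cycle :: "'a set set \<Rightarrow> 'a list \<Rightarrow> bool" where
  "is_cycle E vs \<longleftrightarrow> length vs \<ge> 3 \<and> distinct vs \<and>
     (\<forall>i < length vs. {vs ! i, vs ! (Suc i mod length vs)} \<in> E)"

definition hamiltonian :: "'a set \<Rightarrow> 'a set set \<Rightarrow> bool" where
  "hamiltonian V E \<longleftrightarrow> (\<exists>vs. is_cycle E vs \<and> set vs = V)"

text \<open>
  The distribution of the edge set of $G(n,p)$: one independent Bernoulli variable per potential
  edge, \<open>True\<close> meaning that the edge is present.  To be used with \<open>0 \<le> p \<le> 1\<close> only.
\<close>

definition gnp :: "nat \<Rightarrow> real \<Rightarrow> nat set set pmf" where
  "gnp n p = map_pmf (\<lambda>present. {e \<in> all_edges {1..n}. present e})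
     (Pi_pmf (all_edges {1..n}) False (\<lambda>_. bernoulli_pmf p))"

end

theory Submission
  imports Defs "HOL-Real_Asymp.Real_Asymp"
begin

text \<open>
  Put \<open>a = max \<alpha> (1/n)\<close> and expose \<open>G(n,p)\<close> in two stages, the first with edge probability
  \<open>c/n\<close> where \<open>c = (1 + \<epsilon>/2) ln (1/a)\<close>. The expected number of vertices of degree less than 32 in
  the first stage is about \<open>n e\<^sup>-\<^sup>c = o(a n)\<close>, so with high probability these vertices are far fewer
  than their degrees in \<open>G\<^sub>\<alpha>\<close>. Together with two union bounds for the remaining sets this shows
  that every nonempty set \<open>S\<close> of at most \<open>n/5\<close> vertices has more than \<open>2|S|\<close> outer neighbours.
  By Posa's rotations, a non-Hamiltonian graph with this property has at least about
  \<open>n\<^sup>2/50\<close> boosters: edges whose addition lengthens a longest path or closes a Hamilton cycle.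
  The second stage, with edge probability about \<open>\<epsilon> ln (1/a) / (2n)\<close>, is split into rounds with
  edge probability \<open>50/n\<^sup>2\<close> each. A round makes progress with probability at least 1/2, at most
  \<open>n + 1\<close> steps of progress are possible, and the number of rounds is of larger order than \<open>n\<close>.
\<close>

section \<open>Rotations and boosters\<close>

definition nbh :: "'a set set \<Rightarrow> 'a set \<Rightarrow> 'a set" where
  "nbh E S = {y. y \<notin> S \<and> (\<exists>x\<in>S. {x, y} \<in> E)}"

text \<open>The inequality is strict because Posa's lemma bounds the outer neighbourhood of a set of
  endpoints by twice its size; a set of endpoints therefore cannot be among the expanding
  ones.\<close>

definition expander :: "'a set \<Rightarrow> 'a set set \<Rightarrow> nat \<Rightarrow> bool" where
  "expander V E k \<longleftrightarrow>
     (\<forall>S. S \<subseteq> V \<longrightarrow> S \<noteq> {} \<longrightarrow> card S \<le> k \<longrightarrow> 2 * card S < card (nbh E S))"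

text \<open>Connectedness, phrased through cuts: in this form it supplies the edge along which a
  cycle that misses a vertex can be left.\<close>

definition cut_edge :: "'a set \<Rightarrow> 'a set set \<Rightarrow> bool" where
  "cut_edge V E \<longleftrightarrow>
     (\<forall>W. W \<subseteq> V \<longrightarrow> W \<noteq> {} \<longrightarrow> W \<noteq> V \<longrightarrow> (\<exists>x\<in>W. \<exists>y\<in>V - W. {x, y} \<in> E))"

section \<open>Paths as vertex lists\<close>

fun path_edges :: "'a list \<Rightarrow> 'a set set" where
  "path_edges (x # y # xs) = insert {x, y} (path_edges (y # xs))"
| "path_edges xs = {}"

definition is_path :: "'a set set \<Rightarrow> 'a list \<Rightarrow> bool" where
  "is_path E xs \<longleftrightarrow> distinct xs \<and> path_edges xs \<subseteq> E"

lemma path_edges_append: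
  "xs \<noteq> [] \<Longrightarrow> ys \<noteq> [] \<Longrightarrow>
     path_edges (xs @ ys) = insert {last xs, hd ys} (path_edges xs \<union> path_edges ys)"
proof (induction xs rule: path_edges.induct)
  case ("2_2" v)
  then show ?case by (cases ys) auto
qed auto

lemma path_edges_rev: "path_edges (rev xs) = path_edges xs"
proof (induction xs rule: path_edges.induct)
  case (1 x y xs)
  have "path_edges (rev (x # y # xs)) = path_edges (rev (y # xs) @ [x])" by simp
  also have "\<dots> = insert {y, x} (path_edges (rev (y # xs)))"
    by (subst path_edges_append) auto
  finally show ?case using 1 by (simp add: insert_commute)
qed auto

lemma path_edges_subset: "e \<in> path_edges xs \<Longrightarrow> e \<subseteq> set xs"
  by (induction xs rule: path_edges.induct) auto

lemma is_path_rev: "is_path E (rev xs) \<longleftrightarrow> is_path E xs"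
  by (simp add: is_path_def path_edges_rev)

lemma is_path_mono: "is_path E xs \<Longrightarrow> E \<subseteq> E' \<Longrightarrow> is_path E' xs"
  by (auto simp: is_path_def)

text \<open>Only the predecessor and the successor of \<open>z\<close> on the path qualify. At an
  end of the path \<open>last []\<close> or \<open>hd []\<close> is an unspecified vertex, which
  does no harm in an upper bound.\<close>

lemma card_path_neighbours:
  assumes "distinct xs"
  shows "finite {y. {z, y} \<in> path_edges xs} \<and> card {y. {z, y} \<in> path_edges xs} \<le> 2"
proof (cases "z \<in> set xs")
  case False
  then have "{y. {z, y} \<in> path_edges xs} = {}"
    using path_edges_subset by fastforce
  then show ?thesis by simp
next
  case True
  then obtain as bs where xs: "xs = as @ z # bs" by (meson split_list)
  have "{y. {z, y} \<in> path_edges xs} \<subseteq> {last as, hd bs}"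
  proof
    fix y assume "y \<in> {y. {z, y} \<in> path_edges xs}"
    then have y: "{z, y} \<in> path_edges xs" by simp
    have z: "z \<notin> set as" "z \<notin> set bs" using assms xs by auto
    have 1: "path_edges xs \<subseteq> insert {last as, z} (path_edges as \<union> path_edges (z # bs))"
      using xs path_edges_append[of as "z # bs"] by (cases "as = []") auto
    have 2: "path_edges (z # bs) \<subseteq> insert {z, hd bs} (path_edges bs)"
      by (cases bs) auto
    have "{z, y} \<notin> path_edges as" "{z, y} \<notin> path_edges bs"
      using path_edges_subset[of "{z, y}" as] path_edges_subset[of "{z, y}" bs] z by auto
    then have "{z, y} = {last as, z} \<or> {z, y} = {z, hd bs}" using y 1 2 by blast
    then show "y \<in> {last as, hd bs}" by (auto simp: doubleton_eq_iff)
  qed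
  moreover have "card {last as, hd bs} \<le> 2" by (simp add: card_insert_if)
  ultimately show ?thesis
    by (meson card_mono finite.emptyI finite.insertI finite_subset le_trans)
qed

lemma card_path_neighbours_set:
  assumes "distinct xs" "finite S"
  shows "finite {y. \<exists>z\<in>S. {z, y} \<in> path_edges xs}"
    and "card {y. \<exists>z\<in>S. {z, y} \<in> path_edges xs} \<le> 2 * card S"
proof -
  have eq: "{y. \<exists>z\<in>S. {z, y} \<in> path_edges xs} = (\<Union>z\<in>S. {y. {z, y} \<in> path_edges xs})" by auto
  show "finite {y. \<exists>z\<in>S. {z, y} \<in> path_edges xs}"
    unfolding eq by (rule finite_UN_I[OF assms(2)]) (use card_path_neighbours[OF assms(1)] in auto)
  have "card (\<Union>z\<in>S. {y. {z, y} \<in> path_edges xs}) \<le> (\<Sum>z\<in>S. card {y. {z, y} \<in> path_edges xs})"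
    using assms by (rule_tac card_UN_le) auto
  also have "\<dots> \<le> (\<Sum>z\<in>S. 2)"
    using card_path_neighbours[OF assms(1)] by (intro sum_mono) auto
  finally show "card {y. \<exists>z\<in>S. {z, y} \<in> path_edges xs} \<le> 2 * card S" unfolding eq by simp
qed

section \<open>Posa rotations with a fixed starting vertex\<close>

inductive rotation :: "'a set set \<Rightarrow> 'a list \<Rightarrow> 'a list \<Rightarrow> bool" for E P where
  rotation_refl: "rotation E P P"
| rotation_step: "rotation E P (as @ w # bs) \<Longrightarrow> bs \<noteq> [] \<Longrightarrow> {w, last bs} \<in> E \<Longrightarrow>
     rotation E P (as @ w # rev bs)"

lemma path_edges_split:
  "bs \<noteq> [] \<Longrightarrow> path_edges (as @ w # bs) =
     insert {w, hd bs} (path_edges (as @ [w]) \<union> path_edges bs)"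
  using path_edges_append[of "as @ [w]" bs] by simp

lemma rotation_props:
  assumes "rotation E P Q" "is_path E P" "P \<noteq> []"
  shows "is_path E Q \<and> set Q = set P \<and> hd Q = hd P \<and> Q \<noteq> []"
  using assms
proof (induction rule: rotation.induct)
  case rotation_refl
  then show ?case by simp
next
  case (rotation_step as w bs)
  then have IH: "is_path E (as @ w # bs)" "set (as @ w # bs) = set P" "hd (as @ w # bs) = hd P"
    by auto
  \<comment> \<open>The rotation trades the path edge from \<open>w\<close> to \<open>hd bs\<close>
    for the edge from \<open>w\<close> to the old end \<open>last bs\<close>; \<open>hd bs\<close>
    becomes the new end.\<close>
  have "path_edges (as @ w # rev bs) \<subseteq> E"
    using IH(1) rotation_step.hyps
    by (auto simp: is_path_def path_edges_split path_edges_rev hd_rev)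
  then show ?case using IH by (cases as) (auto simp: is_path_def)
qed

definition endpoints :: "'a set set \<Rightarrow> 'a list \<Rightarrow> 'a set" where
  "endpoints E P = {last Q | Q. rotation E P Q}"

lemma endpointsI: "rotation E P Q \<Longrightarrow> last Q = x \<Longrightarrow> x \<in> endpoints E P"
  unfolding endpoints_def by auto

lemma endpointsE:
  assumes "x \<in> endpoints E P"
  obtains Q where "rotation E P Q" "last Q = x"
  using assms unfolding endpoints_def by auto

text \<open>A rotation only changes path edges that meet the set of endpoints, so away from this set
  and its neighbours on \<open>P\<close> all rotated paths look like \<open>P\<close>.\<close>

lemma rotation_path_edges:
  assumes "rotation E P Q" "y \<notin> endpoints E P" "\<forall>z\<in>endpoints E P. {z, y} \<notin> path_edges P"
  shows "{z, y} \<in> path_edges Q \<longleftrightarrow> {z, y} \<in> path_edges P"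
  using assms(1)
proof (induction arbitrary: z rule: rotation.induct)
  case rotation_refl
  then show ?case by simp
next
  case (rotation_step as w bs)
  have l: "last bs \<in> endpoints E P"
    by (rule endpointsI[OF rotation_step.hyps(1)]) (simp add: rotation_step.hyps(2))
  have "rotation E P (as @ w # rev bs)"
    by (rule rotation.rotation_step[OF rotation_step.hyps])
  moreover have "last (as @ w # rev bs) = hd bs" using rotation_step.hyps(2) by (simp add: last_rev)
  ultimately have h: "hd bs \<in> endpoints E P" by (rule endpointsI)
  \<comment> \<open>The vertex after \<open>w\<close> becomes an endpoint. If \<open>y\<close> were
    \<open>w\<close>, this endpoint would be next to \<open>y\<close> on the current path, hence by
    induction next to \<open>y\<close> on \<open>P\<close>, which is excluded.\<close>
  have w: "y \<noteq> w"
  proof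
    assume "y = w"
    then have "{hd bs, y} \<in> path_edges (as @ w # bs)"
      using rotation_step.hyps by (simp add: path_edges_split insert_commute)
    then show False using rotation_step.IH h assms(3) by blast
  qed
  have "{z, y} \<in> path_edges (as @ w # rev bs) \<longleftrightarrow> {z, y} \<in> path_edges (as @ w # bs)"
    using rotation_step.hyps w h l assms(2)
    by (auto simp: path_edges_split path_edges_rev hd_rev doubleton_eq_iff)
  then show ?case using rotation_step.IH by blast
qed

text \<open>If the end of a rotated path \<open>Q\<close> is adjacent to \<open>y\<close>, rotating
  at \<open>y\<close> makes the successor of \<open>y\<close> on \<open>Q\<close> an endpoint. Were
  no endpoint next to \<open>y\<close> on \<open>P\<close>, the path edges at \<open>y\<close> would
  be the same on \<open>Q\<close> as on \<open>P\<close>, a contradiction.\<close>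

lemma posa:
  assumes path: "is_path E P" "P \<noteq> []"
    and maxl: "\<And>Q y. rotation E P Q \<Longrightarrow> {last Q, y} \<in> E \<Longrightarrow> y \<in> set P"
  shows "nbh E (endpoints E P) \<subseteq> {y. \<exists>z\<in>endpoints E P. {z, y} \<in> path_edges P}"
proof
  fix y assume "y \<in> nbh E (endpoints E P)"
  then obtain Q where Q: "rotation E P Q" "{last Q, y} \<in> E" and y: "y \<notin> endpoints E P"
    unfolding nbh_def endpoints_def by auto
  have "y \<in> set Q" using maxl[OF Q] rotation_props[OF Q(1) path] by simp
  then obtain as bs where Qs: "Q = as @ y # bs" by (meson split_list)
  have bs: "bs \<noteq> []"
  proof
    assume "bs = []"
    then have "last Q = y" using Qs by simp
    then show False using y Q(1) unfolding endpoints_def by blast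
  qed
  then have "rotation E P (as @ y # rev bs)"
    using Q Qs by (intro rotation_step) (auto simp: insert_commute)
  moreover have "last (as @ y # rev bs) = hd bs" using bs by (simp add: last_rev)
  ultimately have h: "hd bs \<in> endpoints E P" by (rule endpointsI)
  have "{hd bs, y} \<in> path_edges Q" using bs Qs by (simp add: path_edges_split insert_commute)
  then show "y \<in> {y. \<exists>z\<in>endpoints E P. {z, y} \<in> path_edges P}"
    using rotation_path_edges[OF Q(1) y] h by blast
qed

section \<open>Longest paths, closing edges and boosters\<close>

definition has_path :: "'a set \<Rightarrow> 'a set set \<Rightarrow> nat \<Rightarrow> bool" where
  "has_path V E m \<longleftrightarrow> (\<exists>xs. is_path E xs \<and> set xs \<subseteq> V \<and> length xs = m)"

lemma all_edges_iff: "{x, y} \<in> all_edges V \<longleftrightarrow> x \<in> V \<and> y \<in> V \<and> x \<noteq> y"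
  by (auto simp: all_edges_def card_2_iff doubleton_eq_iff card_insert_if)

lemma edge_ends: "E \<subseteq> all_edges V \<Longrightarrow> {x, y} \<in> E \<Longrightarrow> x \<in> V \<and> y \<in> V"
  using all_edges_iff[of x y V] by auto

text \<open>No rotated path can be prolonged, so Posa's lemma applies: the set of endpoints has at
  most twice as many outer neighbours as elements, and expansion forbids this for sets of size at
  most \<open>k\<close>.\<close>

lemma posa_endpoints:
  assumes fin: "finite V" and E: "E \<subseteq> all_edges V" and ex: "expander V E k"
    and P: "is_path E P" "P \<noteq> []" "set P \<subseteq> V" and mx: "\<not> has_path V E (Suc (length P))"
  shows "k < card (endpoints E P)" "endpoints E P \<subseteq> set P"
proof -
  show sub: "endpoints E P \<subseteq> set P"
    using rotation_props[OF _ P(1,2)] unfolding endpoints_def by force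
  then have fs: "finite (endpoints E P)" using finite_subset by blast
  have mxl: "y \<in> set P" if "rotation E P Q" "{last Q, y} \<in> E" for Q y
  proof (rule ccontr)
    assume y: "y \<notin> set P"
    note r = rotation_props[OF that(1) P(1,2)]
    have len: "length Q = length P"
      using r P(1) unfolding is_path_def by (metis distinct_card)
    have "path_edges (Q @ [y]) = insert {last Q, y} (path_edges Q)"
      using r path_edges_append[of Q "[y]"] by simp
    then have "is_path E (Q @ [y])"
      using r y that(2) by (simp add: is_path_def)
    moreover have "y \<in> V" using edge_ends[OF E that(2)] by simp
    ultimately have "has_path V E (Suc (length P))"
      unfolding has_path_def using r P(3) len by (intro exI[of _ "Q @ [y]"]) auto
    then show False using mx by simp
  qed
  have "card (nbh E (endpoints E P)) \<le> 2 * card (endpoints E P)"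
    using posa[OF P(1,2) mxl] card_path_neighbours_set[OF _ fs, of P] P(1)
    unfolding is_path_def by (meson card_mono le_trans)
  moreover have "endpoints E P \<noteq> {}" unfolding endpoints_def using rotation_refl by blast
  ultimately show "k < card (endpoints E P)"
    using ex sub P(3) unfolding expander_def by (meson leI le_trans not_le subset_trans)
qed

lemma is_cycle_of_path:
  assumes "is_path E xs" "length xs \<ge> 3" "{last xs, hd xs} \<in> E"
  shows "is_cycle E xs"
proof -
  have nth: "{xs ! i, xs ! Suc i} \<in> path_edges xs" if "Suc i < length xs" for i
    using that
  proof (induction xs arbitrary: i rule: path_edges.induct)
    case (1 x y xs)
    then show ?case by (cases i) auto
  qed auto
  have "{xs ! i, xs ! (Suc i mod length xs)} \<in> E" if "i < length xs" for i
  proof (cases "Suc i < length xs")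
    case True
    then show ?thesis using nth assms(1) by (auto simp: is_path_def)
  next
    case False
    then have "Suc i = length xs" using that by simp
    moreover from this have "xs ! i = last xs"
      by (metis diff_Suc_1 last_conv_nth length_0_conv nat.distinct(1))
    moreover have "xs ! 0 = hd xs" using assms(2) by (cases xs) auto
    ultimately show ?thesis using assms(3) by simp
  qed
  then show ?thesis using assms by (auto simp: is_cycle_def is_path_def)
qed

text \<open>The added edge turns \<open>Q\<close> into a cycle. Either the cycle spans
  \<open>V\<close>, or an edge leaves it at some vertex \<open>u\<close>; opening the cycle at
  \<open>u\<close> and starting outside yields a path with one more vertex.\<close>

lemma close_path:
  assumes cut: "cut_edge V E" and Q: "is_path E Q" "length Q \<ge> 3" "set Q \<subseteq> V"
  defines "E' \<equiv> insert {hd Q, last Q} E"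
  shows "has_path V E' (Suc (length Q)) \<or> hamiltonian V E'"
proof (cases "set Q = V")
  case True
  have "is_path E' Q" using Q(1) E'_def is_path_mono by blast
  moreover have "{last Q, hd Q} \<in> E'" unfolding E'_def by (simp add: doubleton_eq_iff)
  ultimately have "is_cycle E' Q" using Q(2) is_cycle_of_path by blast
  then show ?thesis using True hamiltonian_def by blast
next
  case False
  moreover have "set Q \<noteq> {}" using Q(2) by auto
  ultimately obtain u v where uv: "u \<in> set Q" "v \<in> V" "v \<notin> set Q" "{u, v} \<in> E"
    using cut Q(3) unfolding cut_edge_def by blast
  obtain as bs where Qs: "Q = as @ u # bs" using uv(1) by (meson split_list)
  \<comment> \<open>Go around the cycle from \<open>u\<close>. The added edge is used where
    \<open>bs\<close> wraps around to \<open>as\<close>, that is, unless \<open>u\<close> is already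
    the first vertex of \<open>Q\<close>.\<close>
  have "path_edges (v # u # bs @ as) \<subseteq> E'"
  proof (cases "as = []")
    case True
    have "{v, u} \<in> E" using uv(4) by (simp add: insert_commute)
    then show ?thesis using True Q(1) Qs unfolding is_path_def E'_def by auto
  next
    case False
    have "path_edges (v # u # bs @ as) = insert {v, u} (path_edges ((u # bs) @ as))" by simp
    also have "\<dots> = insert {v, u} (insert {last Q, hd Q} (path_edges (u # bs) \<union> path_edges as))"
      using False Qs by (subst path_edges_append) auto
    also have "\<dots> \<subseteq> E'"
    proof -
      have "{v, u} \<in> E" "{last Q, hd Q} = {hd Q, last Q}"
        using uv(4) by (simp_all add: insert_commute)
      moreover have "path_edges (u # bs) \<union> path_edges as \<subseteq> path_edges Q"
        using path_edges_append[of as "u # bs"] False Qs by auto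
      ultimately show ?thesis using Q(1) unfolding is_path_def E'_def by blast
    qed
    finally show ?thesis .
  qed
  then have "is_path E' (v # u # bs @ as)" using Q(1) Qs uv(3) by (auto simp: is_path_def)
  then show ?thesis unfolding has_path_def using Qs Q(3) uv(2)
    by (intro disjI1 exI[of _ "v # u # bs @ as"]) auto
qed

text \<open>The potential function for sprinkling. Initial segments of paths are paths, so for
  finite \<open>V\<close> the count equals the order of a longest path; counting lengths makes
  monotonicity a matter of set inclusion.\<close>

definition progress :: "'a set \<Rightarrow> 'a set set \<Rightarrow> nat" where
  "progress V E = card {m \<in> {1..card V}. has_path V E m} + of_bool (hamiltonian V E)"

lemma has_path_mono: "has_path V E m \<Longrightarrow> E \<subseteq> E' \<Longrightarrow> has_path V E' m"
  unfolding has_path_def using is_path_mono by blast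

lemma hamiltonian_mono: "hamiltonian V E \<Longrightarrow> E \<subseteq> E' \<Longrightarrow> hamiltonian V E'"
  unfolding hamiltonian_def is_cycle_def by blast

lemma progress_mono: "E \<subseteq> E' \<Longrightarrow> progress V E \<le> progress V E'"
  unfolding progress_def
  by (intro add_mono card_mono) (auto simp: of_bool_def intro: has_path_mono hamiltonian_mono)

lemma progress_le: "progress V E \<le> card V + 1"
proof -
  have "card {m \<in> {1..card V}. has_path V E m} \<le> card {1..card V}" by (intro card_mono) auto
  then show ?thesis by (simp add: progress_def)
qed

definition boosters :: "'a set \<Rightarrow> 'a set set \<Rightarrow> 'a set set" where
  "boosters V E = {e \<in> all_edges V. progress V E < progress V (insert e E)}"

text \<open>An edge arises from at most two ordered pairs. This is the factor 2 lost when boosters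
  are counted through their ordered ends.\<close>

lemma card_pairs_le:
  assumes "finite A" "finite F" "\<And>x y. (x, y) \<in> A \<Longrightarrow> {x, y} \<in> F"
  shows "card A \<le> 2 * card F"
proof -
  have fib: "finite {(x, y). {x, y} = e} \<and> card {(x, y). {x, y} = e} \<le> 2" for e :: "'a set"
  proof (cases "\<exists>a b. e = {a, b}")
    case True
    then obtain a b where e: "e = {a, b}" by auto
    have sub: "{(x, y). {x, y} = e} \<subseteq> {(a, b), (b, a)}"
      unfolding e by (auto simp: doubleton_eq_iff)
    have "card {(a, b), (b, a)} \<le> 2"
      by (cases "a = b") simp_all
    then show ?thesis using card_mono[OF _ sub] finite_subset[OF sub] by simp
  next
    case False
    then have "{(x, y). {x, y} = e} = {}" by auto
    then show ?thesis by simp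
  qed
  have "card A \<le> card (\<Union>e\<in>F. {(x, y). {x, y} = e})"
    using assms fib by (intro card_mono) auto
  also have "\<dots> \<le> (\<Sum>e\<in>F. card {(x, y). {x, y} = e})" by (intro card_UN_le assms)
  also have "\<dots> \<le> (\<Sum>e\<in>F. 2)" using fib by (intro sum_mono) auto
  finally show ?thesis by simp
qed

lemma finite_all_edges: "finite V \<Longrightarrow> finite (all_edges V)"
  unfolding all_edges_def by (rule finite_subset[of _ "Pow V"]) auto

text \<open>Rotate a longest path to obtain more than \<open>k\<close> ends \<open>x\<close>. For
  each of them reverse the rotated path and rotate again with \<open>x\<close> fixed, which gives
  more than \<open>k\<close> ends \<open>y\<close>. Every pair \<open>{x, y}\<close> joins the ends
  of a longest path, so by \<open>close_path\<close> it is a booster.\<close>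

lemma card_boosters:
  assumes fin: "finite V" and V: "V \<noteq> {}" and E: "E \<subseteq> all_edges V"
    and ex: "expander V E k" and k: "k \<ge> 1" and cut: "cut_edge V E" and nh: "\<not> hamiltonian V E"
  shows "(k + 1)\<^sup>2 \<le> 2 * card (boosters V E)"
proof -
  define M where "M = {m \<in> {1..card V}. has_path V E m}"
  have len_le: "length xs \<le> card V" if "is_path E' xs" "set xs \<subseteq> V" for E' xs
    using that fin card_mono[of V "set xs"] by (auto simp: is_path_def distinct_card)
  obtain v where "v \<in> V" using V by auto
  then have "has_path V E 1"
    unfolding has_path_def by (intro exI[of _ "[v]"]) (auto simp: is_path_def)
  then have "1 \<in> M" using fin V by (auto simp: M_def Suc_le_eq card_gt_0_iff)
  then have M: "finite M" "M \<noteq> {}" by (auto simp: M_def)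
  then have "Max M \<in> M" by simp
  then obtain P where P: "is_path E P" "set P \<subseteq> V" "length P = Max M" "length P \<ge> 1"
    unfolding M_def has_path_def by auto
  have Pne: "P \<noteq> []" using P(4) by auto
  have mx: "\<not> has_path V E (Suc (length P))"
  proof
    assume h: "has_path V E (Suc (length P))"
    then have "Suc (length P) \<le> card V" using len_le unfolding has_path_def by metis
    then have "Suc (length P) \<in> M" using h by (auto simp: M_def)
    then show False using P(3) Max_ge[OF M(1)] by fastforce
  qed
  have boost: "e \<in> boosters V E"
    if e: "e \<in> all_edges V"
      and "has_path V (insert e E) (Suc (length P)) \<or> hamiltonian V (insert e E)" for e
    using that(2)
  proof
    assume "hamiltonian V (insert e E)"
    moreover have "card {m \<in> {1..card V}. has_path V E m} \<le>
        card {m \<in> {1..card V}. has_path V (insert e E) m}"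
      by (intro card_mono) (auto intro: has_path_mono[of V E _ "insert e E"])
    ultimately show ?thesis using nh e by (simp add: boosters_def progress_def)
  next
    assume h: "has_path V (insert e E) (Suc (length P))"
    then have "Suc (length P) \<le> card V" using len_le unfolding has_path_def by metis
    then have "{m \<in> {1..card V}. has_path V E m} \<subset> {m \<in> {1..card V}. has_path V (insert e E) m}"
      using h mx has_path_mono[of V E _ "insert e E"] by (intro psubsetI) auto
    then have "card {m \<in> {1..card V}. has_path V E m} <
        card {m \<in> {1..card V}. has_path V (insert e E) m}"
      by (intro psubset_card_mono) auto
    then show ?thesis using nh e by (simp add: boosters_def progress_def)
  qed
  \<comment> \<open>Cycles need three vertices. By maximality all neighbours of the last vertex lie
    on \<open>P\<close>, and expansion of a singleton gives more than two of them.\<close>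
  have P3: "length P \<ge> 3"
  proof -
    have "nbh E {last P} \<subseteq> set P"
    proof
      fix y assume "y \<in> nbh E {last P}"
      then have y: "{last P, y} \<in> E" by (auto simp: nbh_def)
      show "y \<in> set P"
      proof (rule ccontr)
        assume "y \<notin> set P"
        then have "is_path E (P @ [y])" using P(1) y Pne
          by (auto simp: is_path_def path_edges_append)
        moreover have "y \<in> V" using edge_ends[OF E y] by simp
        ultimately have "has_path V E (Suc (length P))"
          unfolding has_path_def using P by (intro exI[of _ "P @ [y]"]) auto
        then show False using mx by simp
      qed
    qed
    then have "card (nbh E {last P}) \<le> length P"
      by (meson List.finite_set card_length card_mono le_trans)
    moreover have "2 * card {last P} < card (nbh E {last P})"
      using ex P(2) Pne k unfolding expander_def by (metis One_nat_def card.empty card_insert_disjoint empty_iff empty_subsetI finite.emptyI in_mono insert_not_empty insert_subset last_in_set)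
    ultimately show ?thesis by simp
  qed
  \<comment> \<open>One rotated path ending in \<open>x\<close> is chosen; reversed, it starts in
    \<open>x\<close>, the vertex that further rotations keep fixed.\<close>
  define T where "T x = endpoints E (rev (SOME Q. rotation E P Q \<and> last Q = x))" for x
  have T: "k < card (T x) \<and> finite (T x) \<and> (\<forall>y\<in>T x. {x, y} \<in> boosters V E)"
    if "x \<in> endpoints E P" for x
  proof -
    define Q where "Q = (SOME Q. rotation E P Q \<and> last Q = x)"
    have "\<exists>Q. rotation E P Q \<and> last Q = x" using that by (auto simp: endpoints_def)
    then have Q: "rotation E P Q" "last Q = x"
      unfolding Q_def by (metis (mono_tags, lifting) someI_ex)+
    note r = rotation_props[OF Q(1) P(1) Pne]
    have len: "length Q = length P" using r P(1) by (metis distinct_card is_path_def)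
    have R: "is_path E (rev Q)" "rev Q \<noteq> []" "set (rev Q) \<subseteq> V"
      using r P(2) by (auto simp: is_path_rev)
    have Teq: "T x = endpoints E (rev Q)" by (simp add: T_def Q_def)
    have c: "k < card (T x)" "T x \<subseteq> set (rev Q)"
      using posa_endpoints[OF fin E ex R] mx len Teq by auto
    have "{x, y} \<in> boosters V E" if yT: "y \<in> T x" for y
    proof -
      obtain Q' where Q': "rotation E (rev Q) Q'" "last Q' = y"
        using yT Teq by (auto elim: endpointsE)
      note r' = rotation_props[OF Q'(1) R(1,2)]
      have len': "length Q' = length P" using r' r len R(1)
        by (metis distinct_card is_path_def length_rev)
      have hd: "hd Q' = x" using r' r Q(2) by (simp add: hd_rev)
      have "x \<noteq> y"
      proof
        assume "x = y"
        moreover obtain a as where Q's: "Q' = a # as" using r' by (cases Q') auto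
        moreover have "as \<noteq> []" using len' P3 Q's by auto
        ultimately show False using hd Q'(2) r' last_in_set[of as] by (auto simp: is_path_def)
      qed
      moreover have "x \<in> V" "y \<in> V"
        using hd Q'(2) r' R(3) r by (metis hd_in_set last_in_set subsetD)+
      ultimately have "{x, y} \<in> all_edges V" by (simp add: all_edges_iff)
      moreover have "has_path V (insert {x, y} E) (Suc (length P)) \<or> hamiltonian V (insert {x, y} E)"
        using close_path[OF cut, of Q'] r' len' P3 R(3) hd Q'(2) by auto
      ultimately show ?thesis by (rule boost)
    qed
    then show ?thesis using c finite_subset by blast
  qed
  have S: "k < card (endpoints E P)" "endpoints E P \<subseteq> set P"
    using posa_endpoints[OF fin E ex P(1) Pne P(2) mx] by auto
  then have fS: "finite (endpoints E P)" using finite_subset by blast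
  have fb: "finite (boosters V E)"
    unfolding boosters_def using finite_all_edges[OF fin] by simp
  have "(k + 1)\<^sup>2 \<le> card (endpoints E P) * (k + 1)"
    using S(1) unfolding power2_eq_square by (intro mult_right_mono) auto
  also have "\<dots> = (\<Sum>x\<in>endpoints E P. k + 1)" by simp
  also have "\<dots> \<le> (\<Sum>x\<in>endpoints E P. card (T x))" using T by (intro sum_mono) force
  also have "\<dots> = card (SIGMA x:endpoints E P. T x)" using fS T by simp
  also have "\<dots> \<le> 2 * card (boosters V E)"
    using fS fb T by (intro card_pairs_le) auto
  finally show ?thesis .
qed

text \<open>A side of a cut without crossing edges contains all its neighbours, so expansion forces
  it to have at least \<open>3 * k + 1\<close> vertices. Two such sides need
  \<open>6 * k + 2\<close> vertices, one more than allowed.\<close>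

lemma expander_cut_edge:
  assumes fin: "finite V" and E: "E \<subseteq> all_edges V" and ex: "expander V E k"
    and k: "card V \<le> 6 * k + 1" "card V \<ge> k" "k \<ge> 1"
  shows "cut_edge V E"
  unfolding cut_edge_def
proof (intro allI impI, rule ccontr)
  fix W assume W: "W \<subseteq> V" "W \<noteq> {}" "W \<noteq> V"
    and no: "\<not> (\<exists>x\<in>W. \<exists>y\<in>V - W. {x, y} \<in> E)"
  have big: "3 * k < card U" if U: "U \<subseteq> V" "U \<noteq> {}" "\<And>S. S \<subseteq> U \<Longrightarrow> nbh E S \<subseteq> U" for U
  proof -
    have fU: "finite U" using fin U finite_subset by blast
    have pos: "card U \<ge> 1" using fU U(2) by (simp add: Suc_le_eq card_gt_0_iff)
    \<comment> \<open>If \<open>U\<close> had fewer than \<open>k\<close> vertices, \<open>S\<close>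
      would be all of \<open>U\<close>, and the final inequality would read
      \<open>3 * card U < card U\<close>. So the minimum is \<open>k\<close>.\<close>
    obtain S where S: "S \<subseteq> U" "card S = min k (card U)"
      by (meson min.cobounded2 obtain_subset_with_card_n)
    have fS: "finite S" using S fU finite_subset by blast
    have "S \<noteq> {}" using S pos k by auto
    moreover have "S \<subseteq> V" "card S \<le> k" using S U(1) by auto
    ultimately have "2 * card S < card (nbh E S)"
      using ex unfolding expander_def by blast
    moreover have "finite (nbh E S)" using U(3)[OF S(1)] fU finite_subset by blast
    moreover have "S \<inter> nbh E S = {}" by (auto simp: nbh_def)
    ultimately have "3 * card S < card (S \<union> nbh E S)" using fS by (simp add: card_Un_disjoint)
    also have "\<dots> \<le> card U" using U(3)[OF S(1)] S(1) fU by (intro card_mono) auto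
    finally show ?thesis using S(2) by (auto simp: min_def split: if_splits)
  qed
  have "3 * k < card W"
  proof (rule big[OF W(1,2)])
    fix S assume "S \<subseteq> W"
    show "nbh E S \<subseteq> W"
    proof
      fix y assume "y \<in> nbh E S"
      then obtain x where x: "x \<in> S" "{x, y} \<in> E" by (auto simp: nbh_def)
      then have "y \<in> V" using edge_ends[OF E x(2)] by simp
      then show "y \<in> W" using no x \<open>S \<subseteq> W\<close> by auto
    qed
  qed
  moreover have "3 * k < card (V - W)"
  proof (rule big)
    fix S assume S: "S \<subseteq> V - W"
    show "nbh E S \<subseteq> V - W"
    proof
      fix y assume "y \<in> nbh E S"
      then obtain x where x: "x \<in> S" "{x, y} \<in> E" by (auto simp: nbh_def)
      then have "y \<in> V" using edge_ends[OF E x(2)] by simp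
      moreover have "{y, x} \<in> E" using x(2) by (simp add: insert_commute)
      ultimately show "y \<in> V - W" using no x(1) S by auto
    qed
  qed (use W in auto)
  moreover have "card W + card (V - W) = card V"
    using W(1) fin by (metis card_Diff_subset card_mono finite_subset le_add_diff_inverse)
  ultimately show False using k by linarith
qed

section \<open>Random subsets and sprinkling\<close>

definition random_subset :: "'a set \<Rightarrow> real \<Rightarrow> 'a set pmf" where
  "random_subset A p = map_pmf (\<lambda>f. {e \<in> A. f e}) (Pi_pmf A False (\<lambda>_. bernoulli_pmf p))"

lemma gnp_random_subset: "gnp n p = random_subset (all_edges {1..n}) p"
  by (simp add: gnp_def random_subset_def)

lemma set_random_subset: "set_pmf (random_subset A p) \<subseteq> Pow A"
  by (auto simp: random_subset_def)

text \<open>The event restricts each coordinate separately, so independence gives a product over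
  \<open>A\<close>; elements outside \<open>X\<close> and \<open>Y\<close> contribute 1.\<close>

lemma prob_random_subset_cylinder:
  assumes "finite A" "X \<subseteq> A" "Y \<subseteq> A" "X \<inter> Y = {}" "0 \<le> p" "p \<le> 1"
  shows "measure_pmf.prob (random_subset A p) {R. X \<subseteq> R \<and> R \<inter> Y = {}} = p ^ card X * (1 - p) ^ card Y"
proof -
  define B where "B x = (if x \<in> X then {True} else if x \<in> Y then {False} else UNIV)" for x
  have "(\<lambda>f. {e \<in> A. f e}) -` {R. X \<subseteq> R \<and> R \<inter> Y = {}} = Pi A B"
    using assms(2-4) by (auto simp: B_def Pi_def split: if_splits)
  then have "measure_pmf.prob (random_subset A p) {R. X \<subseteq> R \<and> R \<inter> Y = {}} =
      (\<Prod>x\<in>A. measure_pmf.prob (bernoulli_pmf p) (B x))"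
    unfolding random_subset_def measure_map_pmf using measure_Pi_pmf_Pi[OF assms(1)] by simp
  also have "\<dots> = (\<Prod>x\<in>A. (if x \<in> X then p else 1) * (if x \<in> Y then 1 - p else 1))"
    using assms(4-6) by (intro prod.cong refl) (auto simp: B_def measure_pmf_single)
  also have "\<dots> = p ^ card (A \<inter> X) * (1 - p) ^ card (A \<inter> Y)"
    using assms(1) by (simp add: prod.distrib flip: prod.inter_restrict)
  finally show ?thesis using assms(2,3) by (simp add: Int_absorb1)
qed

section \<open>Multi-round exposure and coupling\<close>

lemma bernoulli_pmf_or:
  assumes "0 \<le> p" "p \<le> 1" "0 \<le> q" "q \<le> 1"
  shows "bernoulli_pmf (1 - (1 - p) * (1 - q)) =
    bernoulli_pmf p \<bind> (\<lambda>a. bernoulli_pmf q \<bind> (\<lambda>b. return_pmf (a \<or> b)))"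
proof (rule pmf_eqI)
  fix i
  have "0 \<le> (1 - p) * (1 - q)" "(1 - p) * (1 - q) \<le> 1"
    using assms by (simp_all add: mult_le_one)
  then show "pmf (bernoulli_pmf (1 - (1 - p) * (1 - q))) i =
      pmf (bernoulli_pmf p \<bind> (\<lambda>a. bernoulli_pmf q \<bind> (\<lambda>b. return_pmf (a \<or> b)))) i"
    using assms by (cases i) (simp_all add: pmf_bind algebra_simps)
qed

text \<open>An element is missed by the union exactly if both independent rounds miss it; this is
  done coordinate by coordinate.\<close>

lemma random_subset_union:
  assumes "finite A" "0 \<le> p" "p \<le> 1" "0 \<le> q" "q \<le> 1"
  shows "random_subset A (1 - (1 - p) * (1 - q)) =
    random_subset A p \<bind> (\<lambda>R. map_pmf (\<lambda>R'. R \<union> R') (random_subset A q))"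
proof -
  let ?P = "Pi_pmf A False (\<lambda>_. bernoulli_pmf p)" and ?Q = "Pi_pmf A False (\<lambda>_. bernoulli_pmf q)"
  have "Pi_pmf A False (\<lambda>_. bernoulli_pmf (1 - (1 - p) * (1 - q))) =
      ?P \<bind> (\<lambda>f. Pi_pmf A False (\<lambda>x. bernoulli_pmf q \<bind> (\<lambda>b. return_pmf (f x \<or> b))))"
    unfolding bernoulli_pmf_or[OF assms(2-5)] by (rule Pi_pmf_bind[OF assms(1)])
  also have "\<dots> = ?P \<bind> (\<lambda>f. ?Q \<bind> (\<lambda>g. Pi_pmf A False (\<lambda>x. return_pmf (f x \<or> g x))))"
    by (subst Pi_pmf_bind[OF assms(1), where d' = False]) simp
  finally show ?thesis
    unfolding random_subset_def using assms(1)
    by (simp add: map_bind_pmf bind_map_pmf map_pmf_comp)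
       (auto simp: map_pmf_def intro!: bind_pmf_cong)
qed

lemma expectation_random_subset_union:
  fixes f :: "'a set \<Rightarrow> real"
  assumes "finite A" "0 \<le> p" "p \<le> 1" "0 \<le> q" "q \<le> 1"
  shows "measure_pmf.expectation (random_subset A (1 - (1 - p) * (1 - q))) f =
    measure_pmf.expectation (random_subset A p)
      (\<lambda>R. measure_pmf.expectation (random_subset A q) (\<lambda>R'. f (R \<union> R')))"
proof -
  have fin: "finite (Pow A)" using assms by simp
  have "measure_pmf.expectation (random_subset A (1 - (1 - p) * (1 - q))) f =
    (\<Sum>R\<in>Pow A. pmf (random_subset A p) R *\<^sub>R
       measure_pmf.expectation (map_pmf (\<lambda>R'. R \<union> R') (random_subset A q)) f)"
    unfolding random_subset_union[OF assms]
    using set_random_subset[of A p] set_random_subset[of A q] finite_subset[OF _ fin]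
    by (intro pmf_expectation_bind[OF fin]) auto
  also have "\<dots> = measure_pmf.expectation (random_subset A p)
      (\<lambda>R. measure_pmf.expectation (random_subset A q) (\<lambda>R'. f (R \<union> R')))"
    using set_random_subset[of A p]
    by (subst integral_measure_pmf[OF fin, of "random_subset A p"
          "\<lambda>R. measure_pmf.expectation (random_subset A q) (\<lambda>R'. f (R \<union> R'))"]) auto
  finally show ?thesis .
qed

lemma integrable_random_subset [simp]:
  fixes f :: "'a set \<Rightarrow> real"
  assumes "finite A"
  shows "integrable (measure_pmf (random_subset A p)) f"
  using set_random_subset[of A p] assms
  by (intro integrable_measure_pmf_finite) (auto intro: finite_subset)

lemma expectation_random_subset_mono:
  fixes f g :: "'a set \<Rightarrow> real"
  assumes "finite A" "\<And>R. R \<subseteq> A \<Longrightarrow> f R \<le> g R"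
  shows "measure_pmf.expectation (random_subset A p) f \<le> measure_pmf.expectation (random_subset A p) g"
  using assms set_random_subset[of A p]
  by (intro integral_mono_AE) (auto simp: AE_measure_pmf_iff)

text \<open>Coupling: the denser set is the sparser one together with an independent second round,
  and \<open>U\<close> survives the addition of elements.\<close>

lemma prob_random_subset_mono:
  assumes A: "finite A" and p: "0 \<le> p" "p \<le> p'" "p' \<le> 1"
    and up: "\<And>R R'. R \<in> U \<Longrightarrow> R \<subseteq> R' \<Longrightarrow> R' \<subseteq> A \<Longrightarrow> R' \<in> U"
  shows "measure_pmf.prob (random_subset A p) U \<le> measure_pmf.prob (random_subset A p') U"
proof (cases "p = 1")
  case True
  then show ?thesis using p by simp
next
  case False
  \<comment> \<open>Solves \<open>1 - p' = (1 - p) * (1 - q)\<close>; the case \<open>p = 1\<close>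
    was split off to allow the division.\<close>
  define q where "q = (p' - p) / (1 - p)"
  have q: "0 \<le> q" "q \<le> 1" "p' = 1 - (1 - p) * (1 - q)"
    using p False by (auto simp: q_def field_simps)
  have "measure_pmf.prob (random_subset A p) U = measure_pmf.expectation (random_subset A p) (indicator U)"
    by simp
  also have "\<dots> = measure_pmf.expectation (random_subset A p)
      (\<lambda>R. measure_pmf.expectation (random_subset A q) (\<lambda>R'. indicator U R))" by simp
  also have "\<dots> \<le> measure_pmf.expectation (random_subset A p)
      (\<lambda>R. measure_pmf.expectation (random_subset A q) (\<lambda>R'. indicator U (R \<union> R')))"
    using up by (intro expectation_random_subset_mono[OF A]) (auto simp: indicator_def)
  also have "\<dots> = measure_pmf.expectation (random_subset A p') (indicator U)"
    unfolding q(3) using p q by (intro expectation_random_subset_union[symmetric] A) auto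
  also have "\<dots> = measure_pmf.prob (random_subset A p') U" by simp
  finally show ?thesis .
qed

lemma prob_random_subset_antimono:
  assumes "finite A" "0 \<le> p" "p \<le> p'" "p' \<le> 1"
    and "\<And>R R'. R' \<in> U \<Longrightarrow> R \<subseteq> R' \<Longrightarrow> R' \<subseteq> A \<Longrightarrow> R \<in> U"
  shows "measure_pmf.prob (random_subset A p') U \<le> measure_pmf.prob (random_subset A p) U"
proof -
  have "measure_pmf.prob (random_subset A p) (- U) \<le> measure_pmf.prob (random_subset A p') (- U)"
    using assms by (intro prob_random_subset_mono) auto
  moreover have "measure_pmf.prob M (- U) = 1 - measure_pmf.prob M U" for M
    using measure_pmf.prob_compl[of U M] by (simp add: Compl_eq_Diff_UNIV)
  ultimately show ?thesis by simp
qed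

text \<open>Given a first-round set in \<open>B\<close>, the second round misses all of its at least
  \<open>m\<close> boosters with probability at most \<open>(1 - q) ^ m\<close>, hence at most
  \<open>exp (- 1)\<close>. So the potential rises by at least 1 with probability at least 1/2, and
  it never falls.\<close>

lemma boosting_step:
  fixes \<phi> :: "'a set \<Rightarrow> nat"
  assumes A: "finite A" and p: "0 \<le> p" "p \<le> 1" "0 \<le> q" "q \<le> 1" "q * real m \<ge> 1"
    and mono: "\<And>R R'. R \<subseteq> R' \<Longrightarrow> \<phi> R \<le> \<phi> R'"
    and boost: "\<And>R. R \<subseteq> A \<Longrightarrow> R \<in> B \<Longrightarrow> m \<le> card {e \<in> A. \<phi> R < \<phi> (insert e R)}"
  shows "measure_pmf.expectation (random_subset A p) (\<lambda>R. real (\<phi> R)) + measure_pmf.prob (random_subset A p) B / 2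
    \<le> measure_pmf.expectation (random_subset A (1 - (1 - p) * (1 - q))) (\<lambda>R. real (\<phi> R))"
proof -
  let ?E = "measure_pmf.expectation (random_subset A p)"
  have *: "real (\<phi> R) + indicator B R / 2 \<le>
      measure_pmf.expectation (random_subset A q) (\<lambda>R'. real (\<phi> (R \<union> R')))" if R: "R \<subseteq> A" for R
  proof (cases "R \<in> B")
    case False
    have "measure_pmf.expectation (random_subset A q) (\<lambda>R'. real (\<phi> R)) \<le>
        measure_pmf.expectation (random_subset A q) (\<lambda>R'. real (\<phi> (R \<union> R')))"
      by (intro expectation_random_subset_mono[OF A]) (auto intro: mono)
    then show ?thesis using False by simp
  next
    case True
    define F where "F = {e \<in> A. \<phi> R < \<phi> (insert e R)}"
    have F: "F \<subseteq> A" "m \<le> card F" using boost[OF R True] by (auto simp: F_def)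
    \<comment> \<open>The event that no booster is hit, written with a vacuous
      \<open>{} \<subseteq> R'\<close> to match the cylinder formula.\<close>
    let ?U = "{R'. {} \<subseteq> R' \<and> R' \<inter> F = {}}"
    have "measure_pmf.prob (random_subset A q) ?U = (1 - q) ^ card F"
      using prob_random_subset_cylinder[OF A _ F(1), of "{}" q] p by simp
    also have "\<dots> \<le> (1 - q) ^ m" using p F(2) by (intro power_decreasing) auto
    also have "\<dots> \<le> exp (- q) ^ m" using exp_ge_add_one_self[of "- q"] p by (intro power_mono) auto
    also have "\<dots> = exp (- (q * real m))" by (simp add: exp_of_nat_mult[symmetric] mult.commute)
    also have "\<dots> \<le> exp (- 1)" using p by simp
    also have "\<dots> \<le> 1 / 2" using exp_ge_add_one_self[of 1] by (simp add: exp_minus field_simps)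
    finally have U: "measure_pmf.prob (random_subset A q) ?U \<le> 1 / 2" .
    have "real (\<phi> R) + 1 / 2 \<le> real (\<phi> R) + 1 - measure_pmf.prob (random_subset A q) ?U"
      using U by simp
    also have "\<dots> = measure_pmf.expectation (random_subset A q) (\<lambda>R'. real (\<phi> R) + 1 - indicator ?U R')"
      using A by simp
    also have "\<dots> \<le> measure_pmf.expectation (random_subset A q) (\<lambda>R'. real (\<phi> (R \<union> R')))"
    proof (intro expectation_random_subset_mono[OF A])
      fix R' assume "R' \<subseteq> A"
      show "real (\<phi> R) + 1 - indicator ?U R' \<le> real (\<phi> (R \<union> R'))"
      proof (cases "R' \<in> ?U")
        case True
        then show ?thesis using mono[of R "R \<union> R'"] by simp
      next
        case False
        then obtain e where "e \<in> R'" "e \<in> F" by auto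
        then have "\<phi> R < \<phi> (insert e R)" "\<phi> (insert e R) \<le> \<phi> (R \<union> R')"
          by (auto simp: F_def intro: mono)
        then show ?thesis using False by simp
      qed
    qed
    finally show ?thesis using True by simp
  qed
  have "?E (\<lambda>R. real (\<phi> R)) + measure_pmf.prob (random_subset A p) B / 2 =
      ?E (\<lambda>R. real (\<phi> R) + indicator B R / 2)" using A by simp
  also have "\<dots> \<le> ?E (\<lambda>R. measure_pmf.expectation (random_subset A q) (\<lambda>R'. real (\<phi> (R \<union> R'))))"
    by (intro expectation_random_subset_mono[OF A] *)
  also have "\<dots> = measure_pmf.expectation (random_subset A (1 - (1 - p) * (1 - q))) (\<lambda>R. real (\<phi> R))"
    using p by (intro expectation_random_subset_union[symmetric] A) auto
  finally show ?thesis .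
qed

text \<open>Sprinkling: in each of the \<open>r\<close> rounds the expected progress is at least half the probability
  that \<open>N \<inter> D\<close> still holds, while the total progress is bounded by \<open>M\<close>.\<close>

lemma sprinkling:
  fixes \<phi> :: "'a set \<Rightarrow> nat"
  assumes A: "finite A" and p: "0 \<le> p\<^sub>1" "0 \<le> q" "q * real m \<ge> 1" "p\<^sub>1 + real r * q \<le> p" "p \<le> 1"
    and r: "r > 0"
    and mono: "\<And>R R'. R \<subseteq> R' \<Longrightarrow> \<phi> R \<le> \<phi> R'" and M: "\<And>R. \<phi> R \<le> M"
    and N: "\<And>R R'. R' \<in> N \<Longrightarrow> R \<subseteq> R' \<Longrightarrow> R \<in> N"
    and D: "\<And>R R'. R \<in> D \<Longrightarrow> R \<subseteq> R' \<Longrightarrow> R' \<subseteq> A \<Longrightarrow> R' \<in> D"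
    and boost: "\<And>R. R \<subseteq> A \<Longrightarrow> R \<in> N \<Longrightarrow> R \<in> D \<Longrightarrow> m \<le> card {e \<in> A. \<phi> R < \<phi> (insert e R)}"
  shows "measure_pmf.prob (random_subset A p) N \<le>
    measure_pmf.prob (random_subset A p\<^sub>1) (- D) + 2 * real M / real r"
proof -
  have q1: "q \<le> 1"
  proof -
    have "1 * q \<le> real r * q" using r p(2) by (intro mult_right_mono) auto
    then show ?thesis using p by linarith
  qed
  have p1: "p\<^sub>1 \<le> 1" using p r by (meson add_increasing2 le_add_same_cancel1 mult_nonneg_nonneg of_nat_0_le_iff order_trans)
  \<comment> \<open>The density after \<open>i\<close> rounds.\<close>
  define P where "P i = 1 - (1 - p\<^sub>1) * (1 - q) ^ i" for i :: nat
  define \<delta> where "\<delta> = measure_pmf.prob (random_subset A p) N - measure_pmf.prob (random_subset A p\<^sub>1) (- D)"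
  have pw: "0 \<le> (1 - q) ^ i" "(1 - q) ^ i \<le> 1" for i
    using p q1 by (auto intro: power_le_one)
  have P01: "0 \<le> P i" "P i \<le> 1" "p\<^sub>1 \<le> P i" for i
    using pw[of i] p1 p(1) mult_left_mono[OF pw(2)[of i], of "1 - p\<^sub>1"] by (auto simp: P_def)
  have Ple: "P i \<le> p" if "i \<le> r" for i
  proof -
    \<comment> \<open>Bernoulli's inequality bounds \<open>P i\<close> by
      \<open>p\<^sub>1 + real i * q\<close>, so the rounds together do not exceed the density
      \<open>p\<close>.\<close>
    have "1 - real i * q \<le> (1 - q) ^ i"
      using Bernoulli_inequality[of "- q" i] q1 by simp
    then have "(1 - p\<^sub>1) * (1 - real i * q) \<le> (1 - p\<^sub>1) * (1 - q) ^ i"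
      using p1 by (intro mult_left_mono) auto
    moreover have "real i * q \<le> real r * q" "0 \<le> p\<^sub>1 * (real i * q)"
      using that p by (auto intro: mult_right_mono)
    ultimately show ?thesis using p(4) by (simp add: P_def algebra_simps)
  qed
  \<comment> \<open>Going back from \<open>p\<close> to the smaller density \<open>P i\<close> makes
    the decreasing \<open>N\<close> more likely; going up from \<open>p\<^sub>1\<close> makes
    failure of the increasing \<open>D\<close> less likely. Hence the same lower bound serves all
    rounds.\<close>
  have \<delta>: "\<delta> \<le> measure_pmf.prob (random_subset A (P i)) (N \<inter> D)" if "i \<le> r" for i
  proof -
    have "measure_pmf.prob (random_subset A p) N \<le> measure_pmf.prob (random_subset A (P i)) N"
      using P01 Ple[OF that] p N by (intro prob_random_subset_antimono[OF A]) auto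
    moreover have "measure_pmf.prob (random_subset A (P i)) (- D) \<le> measure_pmf.prob (random_subset A p\<^sub>1) (- D)"
      using P01 p D by (intro prob_random_subset_antimono[OF A]) auto
    moreover have "measure_pmf.prob (random_subset A (P i)) N \<le>
        measure_pmf.prob (random_subset A (P i)) ((N \<inter> D) \<union> (- D))"
      by (intro measure_pmf.finite_measure_mono) auto
    moreover have "\<dots> \<le> measure_pmf.prob (random_subset A (P i)) (N \<inter> D) +
        measure_pmf.prob (random_subset A (P i)) (- D)"
      by (intro measure_Un_le) auto
    ultimately show ?thesis unfolding \<delta>_def by linarith
  qed
  have step: "real i * \<delta> / 2 \<le> measure_pmf.expectation (random_subset A (P i)) (\<lambda>R. real (\<phi> R))"
    if "i \<le> r" for i
    using that
  proof (induction i)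
    case 0
    then show ?case by simp
  next
    case (Suc i)
    have "1 - (1 - P i) * (1 - q) = P (Suc i)" by (simp add: P_def)
    then have "measure_pmf.expectation (random_subset A (P i)) (\<lambda>R. real (\<phi> R)) +
        measure_pmf.prob (random_subset A (P i)) (N \<inter> D) / 2 \<le>
        measure_pmf.expectation (random_subset A (P (Suc i))) (\<lambda>R. real (\<phi> R))"
      using boosting_step[OF A P01(1)[of i] P01(2)[of i] p(2) q1 p(3), of \<phi> "N \<inter> D"] mono boost by auto
    moreover have "\<delta> \<le> measure_pmf.prob (random_subset A (P i)) (N \<inter> D)" using \<delta> Suc.prems by simp
    moreover have "real i * \<delta> / 2 \<le> measure_pmf.expectation (random_subset A (P i)) (\<lambda>R. real (\<phi> R))"
      using Suc by simp
    ultimately show ?case by (simp add: field_simps)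
  qed
  have "real r * \<delta> / 2 \<le> measure_pmf.expectation (random_subset A (P r)) (\<lambda>R. real (\<phi> R))"
    using step by simp
  also have "\<dots> \<le> measure_pmf.expectation (random_subset A (P r)) (\<lambda>R. real M)"
    using M by (intro expectation_random_subset_mono[OF A]) simp
  finally have "real r * \<delta> / 2 \<le> real M" by simp
  then have "\<delta> \<le> 2 * real M / real r" using r by (simp add: field_simps)
  then show ?thesis by (simp add: \<delta>_def)
qed

section \<open>Expansion of the perturbed graph\<close>

text \<open>Double counting of incidences: every edge counted on the left lies in \<open>F\<close>,
  and it has two ends.\<close>

lemma sum_degree_le:
  assumes "finite S" "finite F" "\<And>e. e \<in> F \<Longrightarrow> card e = 2" "\<And>v. v \<in> S \<Longrightarrow> {e \<in> R. v \<in> e} \<subseteq> F"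
  shows "(\<Sum>v\<in>S. degree R v) \<le> 2 * card F"
proof -
  have fe: "finite e" if "e \<in> F" for e using assms(3)[OF that] card.infinite by fastforce
  have fd: "finite {e \<in> R. v \<in> e}" if "v \<in> S" for v
    using assms(2,4) that finite_subset by blast
  have "(\<Sum>v\<in>S. degree R v) = card (SIGMA v:S. {e \<in> R. v \<in> e})"
    using assms(1) fd by (simp add: degree_def)
  also have "\<dots> = card (prod.swap ` (SIGMA v:S. {e \<in> R. v \<in> e}))"
    by (intro card_image[symmetric]) simp
  also have "\<dots> \<le> card (SIGMA e:F. e)"
  proof (intro card_mono)
    show "finite (SIGMA e:F. e)" using assms(2) fe by auto
    show "prod.swap ` (SIGMA v:S. {e \<in> R. v \<in> e}) \<subseteq> (SIGMA e:F. e)" using assms(4) by fastforce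
  qed
  also have "\<dots> = (\<Sum>e\<in>F. card e)" using assms(2) fe by simp
  also have "\<dots> = 2 * card F" using assms(3) by simp
  finally show ?thesis .
qed

lemma degree_le_nbh:
  assumes "finite V" "E \<subseteq> all_edges V" "v \<in> S" "S \<subseteq> V"
  shows "degree E v \<le> card S + card (nbh E S)"
proof -
  have sub: "nbh E S \<subseteq> V" using edge_ends[OF assms(2)] by (auto simp: nbh_def)
  have fin: "finite (S \<union> nbh E S)" using sub assms finite_subset[of _ V] by auto
  have "{e \<in> E. v \<in> e} \<subseteq> (\<lambda>y. {v, y}) ` (S \<union> nbh E S)"
  proof
    fix e assume e: "e \<in> {e \<in> E. v \<in> e}"
    then have "card e = 2" using assms(2) by (auto simp: all_edges_def)
    then obtain y where y: "e = {v, y}" using e by (auto simp: card_2_iff doubleton_eq_iff)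
    then have "y \<in> S \<union> nbh E S" using e assms(3) by (auto simp: nbh_def)
    then show "e \<in> (\<lambda>y. {v, y}) ` (S \<union> nbh E S)" using y by blast
  qed
  then have "degree E v \<le> card ((\<lambda>y. {v, y}) ` (S \<union> nbh E S))"
    unfolding degree_def using fin by (intro card_mono) auto
  also have "\<dots> \<le> card (S \<union> nbh E S)" using fin by (rule card_image_le)
  also have "\<dots> \<le> card S + card (nbh E S)" by (rule card_Un_le)
  finally show ?thesis .
qed

lemma nbh_subset: "E \<subseteq> all_edges V \<Longrightarrow> nbh E S \<subseteq> V - S"
  using edge_ends[of E V] by (auto simp: nbh_def)

text \<open>The threshold 32 fits the absence of dense spots: if \<open>H\<close> has no low vertex
  and \<open>T\<close> is \<open>H\<close> with its neighbours, then \<open>32 * card H\<close> is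
  at most twice the number of edges in \<open>T\<close>, thus below \<open>4 * card T\<close>, and
  \<open>T\<close> is at least 8 times as large as \<open>H\<close>.\<close>

definition low :: "'a set \<Rightarrow> 'a set set \<Rightarrow> 'a set" where
  "low V R = {v \<in> V. degree R v < 32}"

text \<open>Small sets spanning a graph of average degree at least 4, which a sparse random graph is
  unlikely to contain.\<close>

definition dense_spot :: "'a set \<Rightarrow> nat \<Rightarrow> 'a set set \<Rightarrow> bool" where
  "dense_spot V t R \<longleftrightarrow>
     (\<exists>T. T \<subseteq> V \<and> card T \<in> {1..t} \<and> 2 * card T \<le> card {e \<in> R. e \<subseteq> T})"

text \<open>A witness that \<open>S\<close> fails to expand in \<open>R\<close>. Its outer
  neighbourhood is padded to a set \<open>T\<close> of exactly twice the size of \<open>S\<close>,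
  so that the union bound runs over sets of fixed sizes.\<close>

definition hole :: "'a set \<Rightarrow> nat set \<Rightarrow> 'a set set \<Rightarrow> bool" where
  "hole V J R \<longleftrightarrow>
     (\<exists>S T. S \<subseteq> V \<and> card S \<in> J \<and> T \<subseteq> V - S \<and> card T = 2 * card S \<and>
        (\<forall>x\<in>S. \<forall>y\<in>V - S - T. {x, y} \<notin> R))"

text \<open>A set \<open>S\<close> of medium size expands in \<open>R\<close> alone. A small \<open>S\<close> expands in \<open>R\<close> if at least
  half of it has large degree in \<open>R\<close>; otherwise \<open>S\<close> is so small compared with the degrees in
  \<open>G\<close> that the \<open>G\<close>-neighbours of a single vertex suffice.\<close>

lemma expander_union:
  assumes fin: "finite V" and G: "G \<subseteq> all_edges V" and R: "R \<subseteq> all_edges V"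
    and low: "\<And>v. v \<in> V \<Longrightarrow> 6 * card (low V R) \<le> degree G v"
    and sparse: "\<not> dense_spot V t R" and no_hole: "\<not> hole V {s. t < 8 * s \<and> s \<le> k} R"
    and k: "3 * k \<le> card V"
  shows "expander V (G \<union> R) k"
  unfolding expander_def
proof (intro allI impI)
  fix S assume S: "S \<subseteq> V" "S \<noteq> {}" "card S \<le> k"
  have GR: "G \<union> R \<subseteq> all_edges V" using G R by auto
  have fS: "finite S" using S fin finite_subset by blast
  have fR: "finite R" using R finite_all_edges[OF fin] finite_subset by blast
  have fN: "finite (nbh (G \<union> R) S)" using nbh_subset[OF GR] fin finite_subset by blast
  have Spos: "card S > 0" using fS S by (simp add: card_gt_0_iff)
  show "2 * card S < card (nbh (G \<union> R) S)"
  proof (cases "t < 8 * card S")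
    case True
    show ?thesis
    proof (rule ccontr)
      assume "\<not> ?thesis"
      \<comment> \<open>Room for the padding of the neighbourhood, from
        \<open>3 * k \<le> card V\<close>.\<close>
      moreover have "2 * card S \<le> card (V - S)" using k S(1,3) fS by (simp add: card_Diff_subset)
      ultimately have "\<exists>T. nbh (G \<union> R) S \<subseteq> T \<and> T \<subseteq> V - S \<and> card T = 2 * card S"
        using exists_subset_between[OF _ _ nbh_subset[OF GR], of S "2 * card S"] fin by simp
      then obtain T where T: "nbh (G \<union> R) S \<subseteq> T" "T \<subseteq> V - S" "card T = 2 * card S"
        by auto
      have "hole V {s. t < 8 * s \<and> s \<le> k} R"
        unfolding hole_def
      proof (rule exI[of _ S], rule exI[of _ T], intro conjI)
        show "\<forall>x\<in>S. \<forall>y\<in>V - S - T. {x, y} \<notin> R" using T(1) by (auto simp: nbh_def)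
      qed (use S T True in auto)
      then show False using no_hole by simp
    qed
  next
    case small: False
    show ?thesis
    proof (cases "card S \<le> 2 * card (S - low V R)")
      case True
      define H where "H = S - low V R"
      define T where "T = H \<union> nbh R H"
      have fH: "finite H" using fS by (simp add: H_def)
      have fT: "finite T" using fH nbh_subset[OF R, of H] fin finite_subset by (auto simp: T_def)
      have TV: "T \<subseteq> V" using S(1) nbh_subset[OF R, of H] by (auto simp: T_def H_def)
      have Hpos: "card H > 0" using True Spos by (simp add: H_def)
      have HS: "card H \<le> card S" using fS by (auto simp: H_def intro: card_mono)
      have "8 * card H \<le> card T"
      proof (rule ccontr)
        assume less: "\<not> ?thesis"
        have Tpos: "card T \<ge> 1" using Hpos card_mono[OF fT, of H] by (auto simp: T_def)
        have "32 * card H = (\<Sum>v\<in>H. 32)" by simp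
        also have "\<dots> \<le> (\<Sum>v\<in>H. degree R v)"
          using S(1) by (intro sum_mono) (auto simp: H_def low_def)
        also have "\<dots> \<le> 2 * card {e \<in> R. e \<subseteq> T}"
        proof (rule sum_degree_le[OF fH])
          fix v assume v: "v \<in> H"
          show "{e \<in> R. v \<in> e} \<subseteq> {e \<in> R. e \<subseteq> T}"
          proof
            fix e assume e: "e \<in> {e \<in> R. v \<in> e}"
            then have "card e = 2" using R by (auto simp: all_edges_def)
            then obtain y where y: "e = {v, y}" using e by (auto simp: card_2_iff doubleton_eq_iff)
            then show "e \<in> {e \<in> R. e \<subseteq> T}" using e v by (auto simp: T_def nbh_def)
          qed
        qed (use fR R in \<open>auto simp: all_edges_def\<close>)
        \<comment> \<open>Here \<open>card T < 8 * card H \<le> 8 * card S \<le> t\<close>, so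
          \<open>T\<close> is small enough to be covered by \<open>sparse\<close>.\<close>
        also have "card {e \<in> R. e \<subseteq> T} < 2 * card T"
          using sparse TV Tpos less small HS unfolding dense_spot_def by force
        finally show False using less by simp
      qed
      also have "card T \<le> card (S \<union> nbh (G \<union> R) S)"
        using fS fN by (intro card_mono) (auto simp: T_def H_def nbh_def)
      also have "\<dots> \<le> card S + card (nbh (G \<union> R) S)" by (rule card_Un_le)
      finally show ?thesis using True Spos by (simp add: H_def)
    next
      case False
      have fl: "finite (low V R)" using fin by (simp add: low_def)
      have "card S = card (S - low V R) + card (S \<inter> low V R)"
        using fS by (metis card_Diff_subset_Int Int_lower1 add.commute card_mono finite_Int le_add_diff_inverse2)
      moreover have "card (S \<inter> low V R) \<le> card (low V R)" using fl by (intro card_mono) auto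
      \<comment> \<open>More than half of \<open>S\<close> is low, hence
        \<open>card S < 2 * card (low V R)\<close>. The factor 6 in the degree hypothesis leaves
        \<open>2 * card S\<close> neighbours after the at most \<open>card S\<close> inside
        \<open>S\<close> are discounted.\<close>
      ultimately have 1: "3 * card S < 6 * card (low V R)" using False by linarith
      obtain v where v: "v \<in> S" using S(2) by auto
      have "6 * card (low V R) \<le> degree G v" using low v S(1) by auto
      also have "\<dots> \<le> degree (G \<union> R) v"
        unfolding degree_def using finite_all_edges[OF fin] GR
        by (intro card_mono) (auto intro: finite_subset)
      also have "\<dots> \<le> card S + card (nbh (G \<union> R) S)" by (rule degree_le_nbh[OF fin GR v S(1)])
      finally show ?thesis using 1 by linarith
    qed
  qed
qed

section \<open>Union bounds for the three bad events\<close>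

lemma sum_subsets_by_card:
  fixes g :: "nat \<Rightarrow> real"
  assumes "finite V" "finite J"
  shows "(\<Sum>T | T \<subseteq> V \<and> card T \<in> J. g (card T)) = (\<Sum>t\<in>J. real (card V choose t) * g t)"
proof -
  have "(\<Sum>T | T \<subseteq> V \<and> card T \<in> J. g (card T)) =
      (\<Sum>t\<in>J. \<Sum>T | T \<in> {T. T \<subseteq> V \<and> card T \<in> J} \<and> card T = t. g (card T))"
    using assms by (intro sum.group[symmetric]) auto
  also have "\<dots> = (\<Sum>t\<in>J. real (card V choose t) * g t)"
  proof (intro sum.cong refl)
    fix t assume "t \<in> J"
    then have "{T \<in> {T. T \<subseteq> V \<and> card T \<in> J}. card T = t} = {T. T \<subseteq> V \<and> card T = t}" by auto
    then show "(\<Sum>T | T \<in> {T. T \<subseteq> V \<and> card T \<in> J} \<and> card T = t. g (card T)) =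
        real (card V choose t) * g t"
      using n_subsets[OF assms(1), of t] by simp
  qed
  finally show ?thesis .
qed

text \<open>Every outcome in \<open>U\<close> has a certificate \<open>i\<close>: elements
  \<open>X i\<close> that are present and elements \<open>Y i\<close> that are absent. The bounds
  for few edges at a vertex, dense spots and holes are instances.\<close>

lemma prob_union_bound:
  assumes A: "finite A" and I: "finite I" and p: "0 \<le> p" "p \<le> 1"
    and XY: "\<And>i. i \<in> I \<Longrightarrow> X i \<subseteq> A \<and> Y i \<subseteq> A \<and> X i \<inter> Y i = {}"
    and U: "\<And>R. R \<subseteq> A \<Longrightarrow> R \<in> U \<Longrightarrow> \<exists>i\<in>I. X i \<subseteq> R \<and> R \<inter> Y i = {}"
  shows "measure_pmf.prob (random_subset A p) U \<le> (\<Sum>i\<in>I. p ^ card (X i) * (1 - p) ^ card (Y i))"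
proof -
  have "measure_pmf.prob (random_subset A p) U = measure_pmf.prob (random_subset A p) (U \<inter> set_pmf (random_subset A p))"
    by (simp add: measure_Int_set_pmf)
  also have "\<dots> \<le> measure_pmf.prob (random_subset A p) (\<Union>i\<in>I. {R. X i \<subseteq> R \<and> R \<inter> Y i = {}})"
  proof (intro measure_pmf.finite_measure_mono subsetI)
    fix R assume "R \<in> U \<inter> set_pmf (random_subset A p)"
    then show "R \<in> (\<Union>i\<in>I. {R. X i \<subseteq> R \<and> R \<inter> Y i = {}})"
      using U[of R] set_random_subset[of A p] by auto
  qed simp
  also have "\<dots> \<le> (\<Sum>i\<in>I. measure_pmf.prob (random_subset A p) {R. X i \<subseteq> R \<and> R \<inter> Y i = {}})"
    using I by (intro measure_UNION_le) auto
  also have "\<dots> = (\<Sum>i\<in>I. p ^ card (X i) * (1 - p) ^ card (Y i))"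
    using XY p by (intro sum.cong refl prob_random_subset_cylinder[OF A]) auto
  finally show ?thesis .
qed

lemma card_star:
  assumes "finite V" "v \<in> V"
  shows "card {e \<in> all_edges V. v \<in> e} = card V - 1"
proof -
  have "{e \<in> all_edges V. v \<in> e} = (\<lambda>y. {v, y}) ` (V - {v})"
    using assms(2) by (auto simp: all_edges_def card_2_iff card_insert_if doubleton_eq_iff)
  moreover have "inj_on (\<lambda>y. {v, y}) (V - {v})" by (auto simp: inj_on_def doubleton_eq_iff)
  ultimately show ?thesis using assms by (simp add: card_image)
qed

lemma prob_few:
  assumes A: "finite A" and B: "B \<subseteq> A" and p: "0 \<le> p" "p \<le> 1"
  shows "measure_pmf.prob (random_subset A p) {R. card (R \<inter> B) < K} \<le>
    (\<Sum>j<K. real (card B choose j) * (p ^ j * (1 - p) ^ (card B - j)))"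
proof -
  have fB: "finite B" using A B finite_subset by blast
  have "measure_pmf.prob (random_subset A p) {R. card (R \<inter> B) < K} \<le>
      (\<Sum>X | X \<subseteq> B \<and> card X \<in> {..<K}. p ^ card X * (1 - p) ^ card (B - X))"
  proof (rule prob_union_bound[OF A _ p])
    show "\<exists>X\<in>{X. X \<subseteq> B \<and> card X \<in> {..<K}}. X \<subseteq> R \<and> R \<inter> (B - X) = {}"
      if "R \<in> {R. card (R \<inter> B) < K}" for R
      using that by (intro bexI[of _ "R \<inter> B"]) auto
  qed (use fB B in auto)
  also have "\<dots> = (\<Sum>X | X \<subseteq> B \<and> card X \<in> {..<K}. p ^ card X * (1 - p) ^ (card B - card X))"
    using fB by (intro sum.cong refl) (auto simp: card_Diff_subset finite_subset)
  also have "\<dots> = (\<Sum>j<K. real (card B choose j) * (p ^ j * (1 - p) ^ (card B - j)))"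
    by (rule sum_subsets_by_card[OF fB]) simp
  finally show ?thesis .
qed

text \<open>A certificate is a set \<open>T\<close> with exactly \<open>2 * card T\<close> present
  edges chosen among its pairs.\<close>

lemma prob_dense_spot:
  assumes V: "finite V" and p: "0 \<le> p" "p \<le> 1"
  shows "measure_pmf.prob (random_subset (all_edges V) p) {R. dense_spot V t\<^sub>0 R} \<le>
    (\<Sum>t=1..t\<^sub>0. real (card V choose t) * (real ((t choose 2) choose (2 * t)) * p ^ (2 * t)))"
proof -
  let ?T = "{T. T \<subseteq> V \<and> card T \<in> {1..t\<^sub>0}}"
  let ?X = "\<lambda>T. {X. X \<subseteq> all_edges T \<and> card X = 2 * card T}"
  have fT: "finite T" if "T \<in> ?T" for T using that V finite_subset by auto
  have fX: "finite (?X T)" if "T \<in> ?T" for T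
    using finite_all_edges[OF fT[OF that]] by (auto intro: finite_subset[of _ "Pow (all_edges T)"])
  have "measure_pmf.prob (random_subset (all_edges V) p) {R. dense_spot V t\<^sub>0 R} \<le>
      (\<Sum>(T, X)\<in>(SIGMA T:?T. ?X T). p ^ card X * (1 - p) ^ card ({} :: 'a set set))"
    unfolding case_prod_beta
  proof (rule prob_union_bound[OF finite_all_edges[OF V] _ p])
    show "finite (SIGMA T:?T. ?X T)" using V fX by (intro finite_SigmaI) auto
    show "snd i \<subseteq> all_edges V \<and> {} \<subseteq> all_edges V \<and> snd i \<inter> {} = {}" if "i \<in> (SIGMA T:?T. ?X T)" for i
      using that unfolding all_edges_def by fastforce
    fix R assume R: "R \<subseteq> all_edges V" "R \<in> {R. dense_spot V t\<^sub>0 R}"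
    then obtain T where T: "T \<in> ?T" "2 * card T \<le> card {e \<in> R. e \<subseteq> T}"
      by (auto simp: dense_spot_def)
    then obtain X where X: "X \<subseteq> {e \<in> R. e \<subseteq> T}" "card X = 2 * card T"
      by (meson obtain_subset_with_card_n)
    then have "X \<subseteq> all_edges T" using R by (auto simp: all_edges_def)
    then show "\<exists>i\<in>(SIGMA T:?T. ?X T). snd i \<subseteq> R \<and> R \<inter> {} = {}"
      using T X by (intro bexI[of _ "(T, X)"]) auto
  qed
  also have "\<dots> = (\<Sum>T\<in>?T. \<Sum>X\<in>?X T. p ^ card X)"
    using V fX by (subst sum.Sigma) auto
  also have "\<dots> = (\<Sum>T\<in>?T. real ((card T choose 2) choose (2 * card T)) * p ^ (2 * card T))"
  proof (intro sum.cong refl)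
    fix T assume T: "T \<in> ?T"
    have "card (all_edges T) = card T choose 2"
      unfolding all_edges_def using n_subsets[OF fT[OF T]] by simp
    then have "card (?X T) = (card T choose 2) choose (2 * card T)"
      using n_subsets[OF finite_all_edges[OF fT[OF T]]] by simp
    then show "(\<Sum>X\<in>?X T. p ^ card X) = real ((card T choose 2) choose (2 * card T)) * p ^ (2 * card T)"
      by simp
  qed
  also have "\<dots> = (\<Sum>t=1..t\<^sub>0. real (card V choose t) * (real ((t choose 2) choose (2 * t)) * p ^ (2 * t)))"
    by (rule sum_subsets_by_card[OF V]) simp
  finally show ?thesis .
qed

lemma card_crossing_edges:
  assumes "finite S" "finite W" "S \<inter> W = {}"
  shows "card ((\<lambda>(x, y). {x, y}) ` (S \<times> W)) = card S * card W"
proof -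
  have "inj_on (\<lambda>(x, y). {x, y}) (S \<times> W)"
    using assms(3) by (auto simp: inj_on_def doubleton_eq_iff)
  then show ?thesis by (simp add: card_image card_cartesian_product)
qed

text \<open>A certificate is a pair \<open>S\<close>, \<open>T\<close>; the absent edges are the
  \<open>s * (n - 3 * s)\<close> pairs between \<open>S\<close> and the vertices outside both, where
  \<open>s = card S\<close> and \<open>n = card V\<close>. The choices of \<open>T\<close> are
  counted generously, as subsets of \<open>V\<close>.\<close>

lemma prob_hole:
  assumes V: "finite V" and p: "0 \<le> p" "p \<le> 1" and J: "finite J"
  shows "measure_pmf.prob (random_subset (all_edges V) p) {R. hole V J R} \<le>
    (\<Sum>s\<in>J. real (card V choose s) * (real (card V choose (2 * s)) * (1 - p) ^ (s * (card V - 3 * s))))"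
proof -
  let ?S = "{S. S \<subseteq> V \<and> card S \<in> J}"
  let ?T = "\<lambda>S. {T. T \<subseteq> V - S \<and> card T = 2 * card S}"
  let ?Y = "\<lambda>S T. (\<lambda>(x, y). {x, y}) ` (S \<times> (V - S - T))"
  have fS: "finite ?S" using V by simp
  have fT: "finite (?T S)" for S using V by simp
  have cY: "card (?Y S T) = card S * (card V - 3 * card S)" if "S \<in> ?S" "T \<in> ?T S" for S T
  proof -
    have f: "finite S" "finite T" using that V finite_subset by auto
    have "card (V - S - T) = card V - 3 * card S"
      using that f by (simp add: card_Diff_subset)
    then show ?thesis using card_crossing_edges[of S "V - S - T"] f V by auto
  qed
  have "measure_pmf.prob (random_subset (all_edges V) p) {R. hole V J R} \<le>
      (\<Sum>(S, T)\<in>(SIGMA S:?S. ?T S). p ^ card ({} :: 'a set set) * (1 - p) ^ card (?Y S T))"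
    unfolding case_prod_beta
  proof (rule prob_union_bound[OF finite_all_edges[OF V] _ p])
    show "finite (SIGMA S:?S. ?T S)" using fS fT by (intro finite_SigmaI) auto
    show "{} \<subseteq> all_edges V \<and> (\<lambda>z. {fst z, snd z}) ` (fst i \<times> (V - fst i - snd i)) \<subseteq> all_edges V \<and>
        {} \<inter> (\<lambda>z. {fst z, snd z}) ` (fst i \<times> (V - fst i - snd i)) = {}" if "i \<in> (SIGMA S:?S. ?T S)" for i
      using that by (auto simp: all_edges_iff)
    fix R assume "R \<subseteq> all_edges V" "R \<in> {R. hole V J R}"
    then obtain S T where "S \<in> ?S" "T \<in> ?T S" "\<forall>x\<in>S. \<forall>y\<in>V - S - T. {x, y} \<notin> R"
      by (auto simp: hole_def)
    then show "\<exists>i\<in>(SIGMA S:?S. ?T S). {} \<subseteq> R \<and> R \<inter> (\<lambda>z. {fst z, snd z}) ` (fst i \<times> (V - fst i - snd i)) = {}"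
      by (intro bexI[of _ "(S, T)"]) auto
  qed
  also have "\<dots> = (\<Sum>S\<in>?S. \<Sum>T\<in>?T S. (1 - p) ^ card (?Y S T))"
    using fS fT by (subst sum.Sigma) auto
  also have "\<dots> = (\<Sum>S\<in>?S. \<Sum>T\<in>?T S. (1 - p) ^ (card S * (card V - 3 * card S)))"
    using cY by (intro sum.cong refl) (metis (no_types, lifting))
  also have "\<dots> \<le> (\<Sum>S\<in>?S. real (card V choose (2 * card S)) * (1 - p) ^ (card S * (card V - 3 * card S)))"
  proof (intro sum_mono)
    fix S assume "S \<in> ?S"
    have "card (?T S) \<le> card {T. T \<subseteq> V \<and> card T = 2 * card S}"
      using V by (intro card_mono) auto
    then have "card (?T S) \<le> card V choose (2 * card S)" using n_subsets[OF V] by simp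
    then show "(\<Sum>T\<in>?T S. (1 - p) ^ (card S * (card V - 3 * card S))) \<le>
        real (card V choose (2 * card S)) * (1 - p) ^ (card S * (card V - 3 * card S))"
      using p by (simp add: mult_right_mono)
  qed
  also have "\<dots> = (\<Sum>s\<in>J. real (card V choose s) * (real (card V choose (2 * s)) * (1 - p) ^ (s * (card V - 3 * s))))"
    by (rule sum_subsets_by_card[OF V J])
  finally show ?thesis .
qed

text \<open>Markov's inequality for the number of low vertices; the degree of each is the number of
  present edges in a star of \<open>card V - 1\<close> pairs.\<close>

lemma prob_many_low:
  assumes V: "finite V" and p: "0 \<le> p" "p \<le> 1" and x: "x > 0"
  shows "measure_pmf.prob (random_subset (all_edges V) p) {R. x \<le> real (card (low V R))} \<le>
    real (card V) / x * (\<Sum>j<32. real ((card V - 1) choose j) * (p ^ j * (1 - p) ^ (card V - 1 - j)))"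
proof -
  let ?M = "random_subset (all_edges V) p"
  let ?s = "\<Sum>j<32. real ((card V - 1) choose j) * (p ^ j * (1 - p) ^ (card V - 1 - j))"
  note A = finite_all_edges[OF V]
  have "x * measure_pmf.prob ?M {R. x \<le> real (card (low V R))} =
      measure_pmf.expectation ?M (\<lambda>R. x * indicator {R. x \<le> real (card (low V R))} R)"
    by simp
  also have "\<dots> \<le> measure_pmf.expectation ?M (\<lambda>R. \<Sum>v\<in>V. indicator {R. card (R \<inter> {e \<in> all_edges V. v \<in> e}) < 32} R)"
  proof (intro expectation_random_subset_mono[OF A])
    fix R assume R: "R \<subseteq> all_edges V"
    have "real (card (low V R)) = (\<Sum>v\<in>V. if degree R v < 32 then 1 else 0)"
      using V by (simp add: low_def sum.If_cases Int_def)
    also have "\<dots> = (\<Sum>v\<in>V. indicator {R. card (R \<inter> {e \<in> all_edges V. v \<in> e}) < 32} R)"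
    proof (intro sum.cong refl)
      fix v
      have "R \<inter> {e \<in> all_edges V. v \<in> e} = {e \<in> R. v \<in> e}" using R by auto
      then show "(if degree R v < 32 then 1 else 0) =
          (indicator {R. card (R \<inter> {e \<in> all_edges V. v \<in> e}) < 32} R :: real)"
        by (simp add: degree_def)
    qed
    finally show "x * indicator {R. x \<le> real (card (low V R))} R \<le>
        (\<Sum>v\<in>V. indicator {R. card (R \<inter> {e \<in> all_edges V. v \<in> e}) < 32} R)"
      by (auto simp: indicator_def)
  qed
  also have "\<dots> = (\<Sum>v\<in>V. measure_pmf.prob ?M {R. card (R \<inter> {e \<in> all_edges V. v \<in> e}) < 32})"
    using A by (subst Bochner_Integration.integral_sum) auto
  also have "\<dots> \<le> (\<Sum>v\<in>V. ?s)"
  proof (intro sum_mono)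
    fix v assume "v \<in> V"
    then show "measure_pmf.prob ?M {R. card (R \<inter> {e \<in> all_edges V. v \<in> e}) < 32} \<le> ?s"
      using prob_few[OF A _ p, of "{e \<in> all_edges V. v \<in> e}" 32] card_star[OF V] by simp
  qed
  finally show ?thesis using x by (simp add: field_simps)
qed

section \<open>Estimates for the union bounds\<close>

text \<open>The term \<open>k ^ k / fact k\<close> of the exponential series at \<open>k\<close> is
  at most \<open>exp k\<close>.\<close>

lemma binomial_le_exp_power:
  assumes "k \<ge> 1"
  shows "real (n choose k) \<le> (exp 1 * real n / real k) ^ k"
proof -
  have "real k ^ k / fact k \<le> (\<Sum>i. real k ^ i / fact i)"
    using summable_exp_generic[of "real k"]
      sum_le_suminf[of "\<lambda>i. real k ^ i / fact i" "{k}"]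
    by (simp add: field_simps)
  also have "\<dots> = exp (real k)" by (simp add: exp_def field_simps)
  finally have 1: "real k ^ k \<le> exp (real k) * fact k" by (simp add: field_simps)
  have "real (n choose k) * fact k \<le> real n ^ k"
    using binomial_fact_pow[of n k] by (metis of_nat_fact of_nat_le_iff of_nat_mult of_nat_power)
  then have "real (n choose k) * fact k * real k ^ k \<le> real n ^ k * (exp (real k) * fact k)"
    using 1 by (intro mult_mono) auto
  then have "real (n choose k) * real k ^ k \<le> real n ^ k * exp (real k)" by simp
  then show ?thesis using assms
    by (simp add: power_divide power_mult_distrib exp_of_nat_mult[symmetric] field_simps)
qed

lemma exp_1_le_3: "exp 1 \<le> (3 :: real)"
  using exp_le .

text \<open>Each of the 32 terms is at most \<open>3 * c ^ 32 * exp (- c)\<close>: the hypothesis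
  \<open>33 * p \<le> 1\<close> allows the exponent \<open>n - 1 - j\<close> to be replaced by
  \<open>n\<close> at the cost of a factor \<open>exp 1\<close>.\<close>

lemma low_sum_bound:
  fixes p c :: real
  assumes p: "0 \<le> p" "p \<le> 1" "33 * p \<le> 1" and c: "c = p * real n" "c \<ge> 1"
  shows "(\<Sum>j<32. real ((n - 1) choose j) * (p ^ j * (1 - p) ^ (n - 1 - j))) \<le>
    96 * c ^ 32 * exp (- c)"
proof -
  have term_le: "real ((n - 1) choose j) * (p ^ j * (1 - p) ^ (n - 1 - j)) \<le> c ^ 32 * (3 * exp (- c))"
    if j: "j < 32" for j
  proof -
    have "real ((n - 1) choose j) \<le> real ((n - 1) ^ j)"
      using binomial_fact_pow[of "n - 1" j]
      by (metis fact_ge_1 le_trans mult.right_neutral mult_le_mono2 of_nat_le_iff order_refl)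
    also have "\<dots> \<le> real n ^ j" by (simp add: power_mono)
    finally have "real ((n - 1) choose j) * p ^ j \<le> real n ^ j * p ^ j"
      using p by (intro mult_right_mono) auto
    also have "\<dots> = c ^ j" by (simp add: c power_mult_distrib mult.commute)
    also have "\<dots> \<le> c ^ 32" using c(2) j by (intro power_increasing) auto
    finally have 1: "real ((n - 1) choose j) * p ^ j \<le> c ^ 32" .
    have "(1 - p) ^ (n - 1 - j) \<le> exp (- p) ^ (n - 1 - j)"
      using exp_ge_add_one_self[of "- p"] p by (intro power_mono) auto
    also have "\<dots> = exp (- (p * real (n - 1 - j)))"
      by (simp add: exp_of_nat_mult[symmetric] mult.commute)
    also have "\<dots> \<le> exp (1 - c)"
    proof -
      have "real n - 33 \<le> real (n - 1 - j)" using j by linarith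
      then have "p * (real n - 33) \<le> p * real (n - 1 - j)" using p by (intro mult_left_mono) auto
      then show ?thesis using p(3) c by (simp add: algebra_simps)
    qed
    also have "\<dots> = exp 1 * exp (- c)" by (simp add: exp_diff exp_minus field_simps)
    also have "\<dots> \<le> 3 * exp (- c)" using exp_1_le_3 by simp
    finally have 2: "(1 - p) ^ (n - 1 - j) \<le> 3 * exp (- c)" .
    have "real ((n - 1) choose j) * p ^ j * (1 - p) ^ (n - 1 - j) \<le> c ^ 32 * (3 * exp (- c))"
      using 1 2 p c by (intro mult_mono) auto
    then show ?thesis by (simp add: mult.assoc)
  qed
  have "(\<Sum>j<32. real ((n - 1) choose j) * (p ^ j * (1 - p) ^ (n - 1 - j))) \<le>
      (\<Sum>j<(32::nat). c ^ 32 * (3 * exp (- c)))"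
    by (intro sum_mono term_le) simp
  then show ?thesis by simp
qed

lemma sum_div_power2: "(\<Sum>t=1..m. real t / 2 ^ t) \<le> 2"
proof -
  have "(\<Sum>t=1..m. real t / 2 ^ t) = 2 - (real m + 2) / 2 ^ m"
    by (induction m) (simp_all add: field_simps)
  then show ?thesis by simp
qed

text \<open>The term for \<open>t\<close> is at most the \<open>t\<close>-th power of
  \<open>2 * c\<^sup>2 * t / n\<close>. One factor is kept to gain \<open>1 / n\<close>; the others
  are at most 1/2 by the choice of \<open>t\<^sub>0\<close> and make the sum converge.\<close>

lemma dense_spot_sum_bound:
  fixes p c :: real
  assumes p: "0 \<le> p" and n: "n > 0" and c: "c = p * real n" "c > 0"
    and t\<^sub>0: "real t\<^sub>0 \<le> real n / (4 * c\<^sup>2)"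
  shows "(\<Sum>t=1..t\<^sub>0. real (n choose t) * (real ((t choose 2) choose (2 * t)) * p ^ (2 * t))) \<le> 8 * c\<^sup>2 / real n"
proof -
  have term_le: "real (n choose t) * (real ((t choose 2) choose (2 * t)) * p ^ (2 * t)) \<le>
      4 * c\<^sup>2 / real n * (real t / 2 ^ t)" if t: "t \<in> {1..t\<^sub>0}" for t
  proof -
    have tpos: "real t > 0" using t by simp
    have t2: "real (t choose 2) \<le> real t * real t / 2"
    proof -
      have "2 * (t choose 2) \<le> t * (t - 1)" unfolding choose_two by simp
      also have "\<dots> \<le> t * t" by simp
      finally have "2 * (t choose 2) \<le> t * t" .
      then have "2 * real (t choose 2) \<le> real t * real t"
        by (metis of_nat_le_iff of_nat_mult of_nat_numeral)
      then show ?thesis by simp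
    qed
    have "real ((t choose 2) choose (2 * t)) \<le> (exp 1 * real (t choose 2) / real (2 * t)) ^ (2 * t)"
      using t by (intro binomial_le_exp_power) simp
    also have "\<dots> \<le> (3 * (real t * real t / 2) / real (2 * t)) ^ (2 * t)"
      using t2 exp_1_le_3 by (intro power_mono divide_right_mono mult_mono) auto
    also have "3 * (real t * real t / 2) / real (2 * t) = 3 / 4 * real t" using tpos by simp
    finally have 1: "real ((t choose 2) choose (2 * t)) \<le> ((3 / 4 * real t)\<^sup>2) ^ t"
      by (simp add: power_mult)
    have "real (n choose t) \<le> (exp 1 * real n / real t) ^ t"
      using t by (intro binomial_le_exp_power) simp
    also have "\<dots> \<le> (3 * real n / real t) ^ t"
      using exp_1_le_3 by (intro power_mono divide_right_mono mult_right_mono) auto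
    finally have 2: "real (n choose t) \<le> (3 * real n / real t) ^ t" .
    have "real (n choose t) * (real ((t choose 2) choose (2 * t)) * p ^ (2 * t)) \<le>
        (3 * real n / real t) ^ t * (((3 / 4 * real t)\<^sup>2) ^ t * p ^ (2 * t))"
      using 1 2 p by (intro mult_mono) auto
    also have "\<dots> = (3 * real n / real t * ((3 / 4 * real t)\<^sup>2 * p\<^sup>2)) ^ t"
      by (simp only: power_mult_distrib power_mult)
    also have "3 * real n / real t * ((3 / 4 * real t)\<^sup>2 * p\<^sup>2) = 27 / 16 * c\<^sup>2 * real t / real n"
      using tpos n by (simp add: c power2_eq_square field_simps)
    also have "(27 / 16 * c\<^sup>2 * real t / real n) ^ t \<le> (2 * c\<^sup>2 * real t / real n) ^ t"
      using n c by (intro power_mono divide_right_mono mult_right_mono) auto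
    also have "\<dots> = (2 * c\<^sup>2 * real t / real n) * (2 * c\<^sup>2 * real t / real n) ^ (t - 1)"
      using t by (cases t) auto
    also have "\<dots> \<le> (2 * c\<^sup>2 * real t / real n) * (1 / 2) ^ (t - 1)"
    proof (intro mult_left_mono power_mono)
      have "real t \<le> real n / (4 * c\<^sup>2)" using t t\<^sub>0 by (auto intro: order_trans[rotated])
      then have "real t * (4 * c\<^sup>2) \<le> real n" using c(2) pos_le_divide_eq[of "4 * c\<^sup>2"] by simp
      then show "2 * c\<^sup>2 * real t / real n \<le> 1 / 2" using n by (simp add: field_simps)
    qed (use n c in auto)
    also have "\<dots> = 4 * c\<^sup>2 / real n * (real t / 2 ^ t)"
      using t n by (cases t) (auto simp: power_divide field_simps)
    finally show ?thesis .
  qed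
  have "(\<Sum>t=1..t\<^sub>0. real (n choose t) * (real ((t choose 2) choose (2 * t)) * p ^ (2 * t))) \<le>
      (\<Sum>t=1..t\<^sub>0. 4 * c\<^sup>2 / real n * (real t / 2 ^ t))"
    by (intro sum_mono term_le)
  also have "\<dots> = 4 * c\<^sup>2 / real n * (\<Sum>t=1..t\<^sub>0. real t / 2 ^ t)"
    by (simp only: sum_distrib_left)
  also have "\<dots> \<le> 4 * c\<^sup>2 / real n * 2"
    by (intro mult_left_mono sum_div_power2) auto
  finally show ?thesis by simp
qed

text \<open>As \<open>n / s\<close> is at most \<open>32 * c\<^sup>2\<close>, the two binomials cost
  \<open>(96 * c\<^sup>2) ^ (3 * s)\<close>. As \<open>s\<close> is at most \<open>n / 5\<close>, at
  least \<open>2 / 5 * n\<close> vertices lie outside \<open>S\<close> and \<open>T\<close>, which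
  gives the exponential factor; a geometric series in \<open>b\<close> remains.\<close>

lemma hole_sum_bound:
  fixes p c :: real
  assumes p: "0 \<le> p" "p \<le> 1" and n: "n > 0" and c: "c = p * real n" "c > 0"
    and k: "5 * k \<le> n" and J: "finite J" "\<And>s. s \<in> J \<Longrightarrow> 1 \<le> s \<and> s \<le> k \<and> real n / real s \<le> 32 * c\<^sup>2"
    and b: "b = (96 * c\<^sup>2) ^ 3 * exp (- 2 / 5 * c)" "b \<le> 1 / 2"
  shows "(\<Sum>s\<in>J. real (n choose s) * (real (n choose (2 * s)) * (1 - p) ^ (s * (n - 3 * s)))) \<le> 2 * b"
proof -
  have b0: "b \<ge> 0" using b by simp
  have term_le: "real (n choose s) * (real (n choose (2 * s)) * (1 - p) ^ (s * (n - 3 * s))) \<le> b ^ s"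
    if s: "s \<in> J" for s
  proof -
    have s1: "1 \<le> s" "s \<le> k" "real n / real s \<le> 32 * c\<^sup>2" using J(2)[OF s] by auto
    have x: "exp 1 * real n / real s \<le> 96 * c\<^sup>2"
    proof -
      have "exp 1 * (real n / real s) \<le> 3 * (32 * c\<^sup>2)"
        using s1 exp_1_le_3 by (intro mult_mono) auto
      then show ?thesis by simp
    qed
    have "real (n choose s) \<le> (exp 1 * real n / real s) ^ s"
      using s1 by (intro binomial_le_exp_power) simp
    also have "\<dots> \<le> (96 * c\<^sup>2) ^ s" using x by (intro power_mono) auto
    finally have 1: "real (n choose s) \<le> (96 * c\<^sup>2) ^ s" .
    have "real (n choose (2 * s)) \<le> (exp 1 * real n / real (2 * s)) ^ (2 * s)"
      using s1 by (intro binomial_le_exp_power) simp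
    also have "\<dots> \<le> (exp 1 * real n / real s) ^ (2 * s)"
      using s1 by (intro power_mono divide_left_mono) auto
    also have "\<dots> \<le> (96 * c\<^sup>2) ^ (2 * s)" using x by (intro power_mono) auto
    finally have 2: "real (n choose (2 * s)) \<le> ((96 * c\<^sup>2)\<^sup>2) ^ s" by (simp add: power_mult)
    have "(1 - p) ^ (s * (n - 3 * s)) \<le> exp (- p) ^ (s * (n - 3 * s))"
      using exp_ge_add_one_self[of "- p"] p by (intro power_mono) auto
    also have "\<dots> = exp (- p * real (n - 3 * s)) ^ s"
      by (simp add: exp_of_nat_mult[symmetric] mult_ac)
    also have "\<dots> \<le> exp (- 2 / 5 * c) ^ s"
    proof (intro power_mono)
      have "2 / 5 * real n \<le> real (n - 3 * s)" using s1 k by linarith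
      then have "p * (2 / 5 * real n) \<le> p * real (n - 3 * s)" using p by (intro mult_left_mono) auto
      then have "2 / 5 * c \<le> p * real (n - 3 * s)" unfolding c(1) by (simp only: mult_ac)
      then show "exp (- p * real (n - 3 * s)) \<le> exp (- 2 / 5 * c)"
        unfolding exp_le_cancel_iff by linarith
    qed auto
    finally have 3: "(1 - p) ^ (s * (n - 3 * s)) \<le> exp (- 2 / 5 * c) ^ s" .
    have "real (n choose s) * (real (n choose (2 * s)) * (1 - p) ^ (s * (n - 3 * s))) \<le>
        (96 * c\<^sup>2) ^ s * (((96 * c\<^sup>2)\<^sup>2) ^ s * exp (- 2 / 5 * c) ^ s)"
      using 1 2 3 p by (intro mult_mono) auto
    also have "\<dots> = (96 * c\<^sup>2 * ((96 * c\<^sup>2)\<^sup>2 * exp (- 2 / 5 * c))) ^ s"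
      by (simp only: power_mult_distrib)
    also have "96 * c\<^sup>2 * ((96 * c\<^sup>2)\<^sup>2 * exp (- 2 / 5 * c)) = b"
      unfolding b(1) by (simp add: power3_eq_cube power2_eq_square)
    finally show ?thesis .
  qed
  have "(\<Sum>s\<in>J. real (n choose s) * (real (n choose (2 * s)) * (1 - p) ^ (s * (n - 3 * s)))) \<le> (\<Sum>s\<in>J. b ^ s)"
    by (intro sum_mono term_le)
  also have "\<dots> \<le> (\<Sum>s=1..k. b ^ s)"
    using J b0 by (intro sum_mono2) auto
  also have "\<dots> \<le> 2 * b"
  proof -
    \<comment> \<open>The subtracted \<open>b ^ k\<close> strengthens the bound so that the
      induction closes, using \<open>2 * b ^ Suc k \<le> b ^ k\<close>.\<close>
    have sum_le: "(\<Sum>s=1..k. b ^ s) \<le> 2 * b - b ^ k" if "k \<ge> 1" for k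
      using that
    proof (induction k rule: dec_induct)
      case (step k)
      have "2 * b ^ Suc k \<le> b ^ k" using b(2) b0 mult_right_mono[of b "1 / 2" "b ^ k"] by simp
      then show ?case using step by simp
    qed simp
    show ?thesis
    proof (cases "k \<ge> 1")
      case True
      have "b ^ k \<ge> 0" using b0 by simp
      then show ?thesis using sum_le[OF True] by linarith
    qed (use b0 in simp)
  qed
  finally show ?thesis .
qed

section \<open>Hamiltonicity\<close>

lemma expander_mono:
  assumes "finite V" "expander V E k" "E \<subseteq> E'" "E' \<subseteq> all_edges V"
  shows "expander V E' k"
  unfolding expander_def
proof (intro allI impI)
  fix S assume S: "S \<subseteq> V" "S \<noteq> {}" "card S \<le> k"
  have "finite (nbh E' S)" using nbh_subset[OF assms(4)] assms(1) finite_subset by blast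
  moreover have "nbh E S \<subseteq> nbh E' S" using assms(3) by (auto simp: nbh_def)
  ultimately have "card (nbh E S) \<le> card (nbh E' S)" by (intro card_mono)
  moreover have "2 * card S < card (nbh E S)" using assms(2) S unfolding expander_def by blast
  ultimately show "2 * card S < card (nbh E' S)" by linarith
qed

text \<open>The three summands bound many low vertices, dense spots and holes. The first alternative
  of \<open>deg\<close> serves minimum degrees that may vanish: then fewer than
  \<open>a * n / 6\<close> low vertices means none at all.\<close>

lemma prob_not_expander:
  fixes a p c :: real and n :: nat
  defines "V \<equiv> {1..n}"
  assumes n: "n > 0" and G: "G \<subseteq> all_edges V" and p: "0 \<le> p" "33 * p \<le> 1"
    and c: "c = p * real n" "c \<ge> 1" and a: "a > 0"
    and deg: "a * real n \<le> 1 \<or> (\<forall>v\<in>V. a * real n \<le> real (degree G v))"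
    and b: "(96 * c\<^sup>2) ^ 3 * exp (- 2 / 5 * c) \<le> 1 / 2"
  shows "measure_pmf.prob (random_subset (all_edges V) p) {R. \<not> expander V (G \<union> R) (n div 5)} \<le>
    576 / a * c ^ 32 * exp (- c) + 8 * c\<^sup>2 / real n + 2 * ((96 * c\<^sup>2) ^ 3 * exp (- 2 / 5 * c))"
proof -
  \<comment> \<open>The largest size for which dense spots are controlled. Sets \<open>S\<close>
    with \<open>t < 8 * card S\<close> then satisfy \<open>n / card S < 32 * c\<^sup>2\<close>, as
    the estimate for holes requires.\<close>
  define t where "t = nat \<lfloor>real n / (4 * c\<^sup>2)\<rfloor>"
  define J where "J = {s. t < 8 * s \<and> s \<le> n div 5}"
  let ?M = "random_subset (all_edges V) p"
  let ?L = "{R. a * real n / 6 \<le> real (card (low V R))}"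
  let ?D = "{R. dense_spot V t R}"
  let ?H = "{R. hole V J R}"
  have V: "finite V" "card V = n" by (simp_all add: V_def)
  have fJ: "finite J" by (rule finite_subset[of _ "{..n div 5}"]) (auto simp: J_def)
  have p1: "p \<le> 1" using p by simp
  have x: "a * real n / 6 > 0" using a n by simp
  have "measure_pmf.prob ?M {R. \<not> expander V (G \<union> R) (n div 5)} =
      measure_pmf.prob ?M ({R. \<not> expander V (G \<union> R) (n div 5)} \<inter> set_pmf ?M)"
    by (simp add: measure_Int_set_pmf)
  also have "\<dots> \<le> measure_pmf.prob ?M (?L \<union> (?D \<union> ?H))"
  proof (intro measure_pmf.finite_measure_mono subsetI)
    fix R assume R: "R \<in> {R. \<not> expander V (G \<union> R) (n div 5)} \<inter> set_pmf ?M"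
    then have RA: "R \<subseteq> all_edges V" using set_random_subset[of "all_edges V" p] by auto
    show "R \<in> ?L \<union> (?D \<union> ?H)"
    proof (rule ccontr)
      assume no: "R \<notin> ?L \<union> (?D \<union> ?H)"
      have "expander V (G \<union> R) (n div 5)"
      proof (rule expander_union[OF V(1) G RA])
        fix v assume v: "v \<in> V"
        have l: "6 * real (card (low V R)) < a * real n" using no by simp
        show "6 * card (low V R) \<le> degree G v"
        proof (cases "a * real n \<le> 1")
          case True
          then have "real (card (low V R)) < 1" using l by linarith
          then show ?thesis by simp
        next
          case False
          then have "a * real n \<le> real (degree G v)" using deg v by auto
          then show ?thesis using l by linarith
        qed
      qed (use no V in \<open>auto simp: J_def\<close>)
      then show False using R by simp
    qed
  qed simp
  also have "\<dots> \<le> measure_pmf.prob ?M ?L + measure_pmf.prob ?M (?D \<union> ?H)"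
    by (intro measure_Un_le) auto
  also have "\<dots> \<le> measure_pmf.prob ?M ?L + (measure_pmf.prob ?M ?D + measure_pmf.prob ?M ?H)"
    by (intro add_left_mono measure_Un_le) auto
  also have "measure_pmf.prob ?M ?L \<le> 576 / a * c ^ 32 * exp (- c)"
  proof -
    have "measure_pmf.prob ?M ?L \<le> real n / (a * real n / 6) *
        (\<Sum>j<32. real ((n - 1) choose j) * (p ^ j * (1 - p) ^ (n - 1 - j)))"
      using prob_many_low[OF V(1) p(1) p1 x] unfolding V(2) .
    also have "\<dots> \<le> real n / (a * real n / 6) * (96 * c ^ 32 * exp (- c))"
      using x a by (intro mult_left_mono low_sum_bound[OF p(1) p1 p(2) c]) auto
    finally have "measure_pmf.prob ?M ?L \<le> real n / (a * real n / 6) * (96 * c ^ 32 * exp (- c))" .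
    then show ?thesis using n a by (simp add: field_simps)
  qed
  also have "measure_pmf.prob ?M ?D \<le> 8 * c\<^sup>2 / real n"
  proof -
    have "real t \<le> real n / (4 * c\<^sup>2)" unfolding t_def by (simp add: of_nat_nat)
    then show ?thesis
      using prob_dense_spot[OF V(1) p(1) p1, of t] dense_spot_sum_bound[OF p(1) n c(1), of t] c(2) V(2)
      by simp
  qed
  also have "measure_pmf.prob ?M ?H \<le> 2 * ((96 * c\<^sup>2) ^ 3 * exp (- 2 / 5 * c))"
  proof -
    have J: "1 \<le> s \<and> s \<le> n div 5 \<and> real n / real s \<le> 32 * c\<^sup>2" if "s \<in> J" for s
    proof -
      have s: "t < 8 * s" "s \<le> n div 5" using that by (auto simp: J_def)
      have "real n / (4 * c\<^sup>2) < real t + 1" unfolding t_def by linarith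
      also have "\<dots> \<le> 8 * real s" using s(1) by linarith
      finally have "real n < 32 * c\<^sup>2 * real s" using c(2) by (simp add: field_simps)
      then show ?thesis using s by (auto simp: field_simps)
    qed
    show ?thesis
      using prob_hole[OF V(1) p(1) p1 fJ] hole_sum_bound[OF p(1) p1 n c(1) _ _ fJ J refl b] c(2) V(2)
      by simp
  qed
  finally show ?thesis by simp
qed

lemma prob_not_hamiltonian:
  fixes a p c l \<epsilon> :: real
  assumes n: "n \<ge> 15" and G: "simple_graph {1..n} G" and \<epsilon>: "\<epsilon> > 0" and a: "a > 0"
    and deg: "a * real n \<le> 1 \<or> (\<forall>v\<in>{1..n}. a * real n \<le> real (degree G v))"
    and c: "c = (1 + \<epsilon> / 2) * l" "c \<ge> 1" "33 * (c / real n) \<le> 1"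
    and p: "(1 + \<epsilon>) * (l / real n) \<le> p" "p \<le> 1"
    and b: "(96 * c\<^sup>2) ^ 3 * exp (- 2 / 5 * c) \<le> 1 / 2"
    and l: "\<epsilon> * l \<ge> 200"
  shows "measure_pmf.prob (gnp n p) {R. \<not> hamiltonian {1..n} (G \<union> R)} \<le>
    576 / a * c ^ 32 * exp (- c) + 8 * c\<^sup>2 / real n + 2 * ((96 * c\<^sup>2) ^ 3 * exp (- 2 / 5 * c)) + 800 / (\<epsilon> * l)"
proof -
  define V where "V = {1..n}"
  define k where "k = n div 5"
  \<comment> \<open>Half of \<open>(k + 1)\<^sup>2\<close>, rounded up: the number of boosters from
    \<open>card_boosters\<close>. Since \<open>k + 1\<close> is at least \<open>n / 5\<close>, it is
    at least \<open>n\<^sup>2 / 50\<close>, which fits the choice of \<open>q\<close>.\<close>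
  define m where "m = ((k + 1)\<^sup>2 + 1) div 2"
  define q where "q = 50 / (real n)\<^sup>2"
  \<comment> \<open>The number of rounds for which \<open>r * q\<close> stays within the spare
    density \<open>\<epsilon> / 2 * (l / n)\<close>.\<close>
  define r where "r = nat \<lfloor>\<epsilon> * l * real n / 100\<rfloor>"
  have V: "finite V" "card V = n" "V \<noteq> {}" using n by (auto simp: V_def)
  have G': "G \<subseteq> all_edges V" using G by (simp add: simple_graph_def V_def)
  have n0: "real n > 0" using n by simp
  \<comment> \<open>From \<open>n \<ge> 15\<close> follows \<open>k \<ge> 3\<close>, so the
    remainder of \<open>n\<close> modulo 5 is at most \<open>k + 1\<close>.\<close>
  have k: "k \<ge> 1" "card V \<le> 6 * k + 1" "k \<le> card V" using n V by (auto simp: k_def)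
  have rr: "real r \<le> \<epsilon> * l * real n / 100" "\<epsilon> * l * real n / 200 \<le> real r"
  proof -
    have "0 \<le> \<epsilon> * l * real n / 100" using l by simp
    then show "real r \<le> \<epsilon> * l * real n / 100" unfolding r_def by linarith
    \<comment> \<open>The number rounded down is at least 2, so rounding loses at most half of
      it.\<close>
    have "200 * 1 \<le> \<epsilon> * l * real n" using l n by (intro mult_mono) auto
    then show "\<epsilon> * l * real n / 200 \<le> real r" unfolding r_def by linarith
  qed
  have r0: "r > 0"
  proof -
    have "\<epsilon> * l * real n / 200 > 0" using l n0 by simp
    then show ?thesis using rr(2) by linarith
  qed
  have qm: "q * real m \<ge> 1"
  proof -
    have "real n / 5 \<le> real (k + 1)" unfolding k_def by linarith
    then have "(real n / 5)\<^sup>2 \<le> (real (k + 1))\<^sup>2" by (intro power_mono) auto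
    also have "\<dots> = real ((k + 1)\<^sup>2)" by simp
    also have "\<dots> \<le> 2 * real m" unfolding m_def by linarith
    finally have "(real n)\<^sup>2 \<le> 50 * real m" by (simp add: power_divide)
    then show ?thesis using n0 by (simp add: q_def field_simps)
  qed
  have rq: "c / real n + real r * q \<le> p"
  proof -
    have "real r * q \<le> \<epsilon> * l * real n / 100 * q" using rr(1) by (intro mult_right_mono) (auto simp: q_def)
    also have "\<dots> = \<epsilon> / 2 * (l / real n)" using n0 by (simp add: q_def power2_eq_square)
    finally show ?thesis using p(1) by (simp add: c(1) algebra_simps add_divide_distrib)
  qed
  have "measure_pmf.prob (random_subset (all_edges V) p) {R. \<not> hamiltonian V (G \<union> R)} \<le>
      measure_pmf.prob (random_subset (all_edges V) (c / real n)) (- {R. expander V (G \<union> R) k})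
        + 2 * real (n + 1) / real r"
  proof (rule sprinkling[OF finite_all_edges[OF V(1)] _ _ qm rq p(2) r0, of "\<lambda>R. progress V (G \<union> R)"])
    show "progress V (G \<union> R) \<le> n + 1" for R using progress_le[of V "G \<union> R"] V(2) by simp
    show "progress V (G \<union> R) \<le> progress V (G \<union> R')" if "R \<subseteq> R'" for R R'
      using that by (intro progress_mono) auto
    show "R \<in> {R. \<not> hamiltonian V (G \<union> R)}"
      if "R' \<in> {R. \<not> hamiltonian V (G \<union> R)}" "R \<subseteq> R'" for R R'
      using that hamiltonian_mono[of V "G \<union> R" "G \<union> R'"] by auto
    show "R' \<in> {R. expander V (G \<union> R) k}"
      if "R \<in> {R. expander V (G \<union> R) k}" "R \<subseteq> R'" "R' \<subseteq> all_edges V" for R R'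
      using that G' expander_mono[OF V(1), of "G \<union> R" k "G \<union> R'"] by auto
    show "m \<le> card {e \<in> all_edges V. progress V (G \<union> R) < progress V (G \<union> insert e R)}"
      if R: "R \<subseteq> all_edges V" "R \<in> {R. \<not> hamiltonian V (G \<union> R)}" "R \<in> {R. expander V (G \<union> R) k}" for R
    proof -
      have GR: "G \<union> R \<subseteq> all_edges V" using G' R by auto
      have ex: "expander V (G \<union> R) k" and nh: "\<not> hamiltonian V (G \<union> R)" using R by auto
      have "(k + 1)\<^sup>2 \<le> 2 * card (boosters V (G \<union> R))"
        by (rule card_boosters[OF V(1,3) GR ex k(1) expander_cut_edge[OF V(1) GR ex k(2,3,1)] nh])
      then show ?thesis by (simp add: m_def boosters_def)
    qed
  qed (use c n0 in \<open>auto simp: q_def\<close>)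
  also have "measure_pmf.prob (random_subset (all_edges V) (c / real n)) (- {R. expander V (G \<union> R) k}) \<le>
      576 / a * c ^ 32 * exp (- c) + 8 * c\<^sup>2 / real n + 2 * ((96 * c\<^sup>2) ^ 3 * exp (- 2 / 5 * c))"
    using prob_not_expander[of n G "c / real n" c a] n G' c n0 a deg b
    by (simp add: V_def k_def Collect_neg_eq)
  also have "2 * real (n + 1) / real r \<le> 800 / (\<epsilon> * l)"
  proof -
    have "2 * real (n + 1) / real r \<le> 4 * real n / (\<epsilon> * l * real n / 200)"
      using rr(2) l n n0 by (intro frac_le) auto
    then show ?thesis using n0 by simp
  qed
  finally show ?thesis by (simp add: gnp_random_subset V_def)
qed

section \<open>Choice of scales and passage to the limit\<close>

theorem theorem1p1:
  fixes \<epsilon> :: real and \<alpha> p :: "nat \<Rightarrow> real" and G :: "nat \<Rightarrow> nat set set"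
  assumes "\<epsilon> > 0"
    and "\<alpha> \<longlonglongrightarrow> 0"
    and "\<forall>\<^sub>F n in sequentially. \<alpha> n > 0"
    and "\<And>n. simple_graph {1..n} (G n)"
    and "\<forall>\<^sub>F n in sequentially. real (min_degree {1..n} (G n)) \<ge> \<alpha> n * real n"
    and "\<And>n. 0 \<le> p n \<and> p n \<le> 1"
    and "\<forall>\<^sub>F n in sequentially. p n \<ge> (1 + \<epsilon>) * (ln (1 / \<alpha> n) / real n)"
  shows "(\<lambda>n. measure_pmf.prob (gnp n (p n)) {R. hamiltonian {1..n} (G n \<union> R)})
           \<longlonglongrightarrow> 1"
proof -
  \<comment> \<open>The cap at \<open>1 / n\<close> gives \<open>l n \<le> ln n\<close>, which keeps
    \<open>c\<^sup>2 / n\<close> and \<open>c / n\<close> small, while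
    \<open>l n \<le> ln (1 / \<alpha> n)\<close> preserves the lower bound on
    \<open>p\<close>.\<close>
  define a where "a n = max (\<alpha> n) (1 / real n)" for n
  define l where "l n = ln (1 / a n)" for n
  define c where "c n = (1 + \<epsilon> / 2) * l n" for n
  define bad where "bad n = measure_pmf.prob (gnp n (p n)) {R. \<not> hamiltonian {1..n} (G n \<union> R)}" for n
  have a0: "a n > 0" if "n > 0" for n
    using that by (simp add: a_def less_max_iff_disj)
  have ev0: "eventually (\<lambda>n. n > (0::nat)) sequentially" by (rule eventually_gt_at_top)
  have ev_a0: "eventually (\<lambda>n. a n > 0) sequentially" using ev0 by eventually_elim (rule a0)
  have "(\<lambda>n. max (\<alpha> n) (1 / real n)) \<longlonglongrightarrow> max 0 0"
    by (intro tendsto_max assms(2) lim_1_over_n)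
  then have "a \<longlonglongrightarrow> 0" by (simp add: a_def[abs_def])
  then have "filterlim (\<lambda>n. inverse (a n)) at_top sequentially"
    using ev_a0 by (rule filterlim_inverse_at_top)
  then have l_top: "filterlim l at_top sequentially"
    unfolding l_def[abs_def] inverse_eq_divide[symmetric] by (rule filterlim_compose[OF ln_at_top])
  have l_le: "l n \<le> ln (real n)" if "n > 0" for n
  proof -
    have "1 / a n \<le> real n" using that a0[OF that] by (simp add: a_def field_simps max_def)
    then show ?thesis unfolding l_def using a0[OF that] that by (intro ln_mono) auto
  qed
  have c_top: "filterlim c at_top sequentially"
    unfolding c_def[abs_def] using assms(1)
    by (intro filterlim_tendsto_pos_mult_at_top[OF tendsto_const] l_top) auto
  have l1: "eventually (\<lambda>n. l n \<ge> 1) sequentially" using l_top by (simp add: filterlim_at_top)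
  have c_le: "c n \<le> (1 + \<epsilon> / 2) * ln (real n)" if "n > 0" for n
    using l_le[OF that] assms(1) unfolding c_def by (intro mult_left_mono) auto
  have lim1: "(\<lambda>n. 576 / a n * c n ^ 32 * exp (- c n)) \<longlonglongrightarrow> 0"
  proof -
    \<comment> \<open>Since \<open>1 / a n = exp (l n)\<close>, dividing by \<open>a n\<close> still
      leaves the decay \<open>exp (- (\<epsilon> / 2 * l n))\<close>, which beats the polynomial
      factor.\<close>
    have "((\<lambda>x. 576 * ((1 + \<epsilon> / 2) * x) ^ 32 * exp (- (\<epsilon> / 2 * x))) \<longlongrightarrow> 0) at_top"
      using assms(1) by real_asymp
    from filterlim_compose[OF this l_top]
    show ?thesis
    proof (rule Lim_transform_eventually)
      show "eventually (\<lambda>n. 576 * ((1 + \<epsilon> / 2) * l n) ^ 32 * exp (- (\<epsilon> / 2 * l n)) =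
          576 / a n * c n ^ 32 * exp (- c n)) sequentially"
        using ev0
      proof eventually_elim
        case (elim n)
        have "exp (- (\<epsilon> / 2 * l n)) = exp (l n) * exp (- c n)"
          by (simp add: c_def exp_add[symmetric] algebra_simps)
        also have "exp (l n) = 1 / a n" using a0[OF elim] by (simp add: l_def)
        finally show ?case by (simp add: c_def)
      qed
    qed
  qed
  have lim2: "(\<lambda>n. 8 * (c n)\<^sup>2 / real n) \<longlonglongrightarrow> 0"
  proof (rule tendsto_sandwich[OF _ _ tendsto_const])
    have "(\<lambda>n. (ln (real n))\<^sup>2 / real n) \<longlonglongrightarrow> 0" by real_asymp
    from tendsto_mult_left[OF this, of "8 * (1 + \<epsilon> / 2)\<^sup>2"]
    show "(\<lambda>n. 8 * ((1 + \<epsilon> / 2) * ln (real n))\<^sup>2 / real n) \<longlonglongrightarrow> 0"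
      by (simp add: power_mult_distrib mult.assoc)
    show "eventually (\<lambda>n. 8 * (c n)\<^sup>2 / real n \<le> 8 * ((1 + \<epsilon> / 2) * ln (real n))\<^sup>2 / real n) sequentially"
      using ev0 l1
    proof eventually_elim
      case (elim n)
      have "0 \<le> c n" using elim assms(1) by (simp add: c_def)
      then show ?case using c_le[OF elim(1)] by (intro divide_right_mono mult_left_mono power_mono) auto
    qed
  qed simp
  have lim3: "(\<lambda>n. (96 * (c n)\<^sup>2) ^ 3 * exp (- 2 / 5 * c n)) \<longlonglongrightarrow> 0"
  proof -
    have "((\<lambda>x::real. (96 * x\<^sup>2) ^ 3 * exp (- 2 / 5 * x)) \<longlongrightarrow> 0) at_top"
      by real_asymp
    from filterlim_compose[OF this c_top] show ?thesis .
  qed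
  have lim4: "(\<lambda>n. 800 / (\<epsilon> * l n)) \<longlonglongrightarrow> 0"
  proof -
    have "((\<lambda>x. 800 / (\<epsilon> * x)) \<longlongrightarrow> 0) at_top" using assms(1) by real_asymp
    from filterlim_compose[OF this l_top] show ?thesis .
  qed
  have lim5: "(\<lambda>n. 33 * ((1 + \<epsilon> / 2) * ln (real n) / real n)) \<longlonglongrightarrow> 0" by real_asymp
  have e1: "eventually (\<lambda>n. c n \<ge> 1) sequentially" using c_top by (simp add: filterlim_at_top)
  have e2: "eventually (\<lambda>n. l n \<ge> 200 / \<epsilon>) sequentially" using l_top by (simp add: filterlim_at_top)
  have e3: "eventually (\<lambda>n. (96 * (c n)\<^sup>2) ^ 3 * exp (- 2 / 5 * c n) < 1 / 2) sequentially"
    using lim3 by (rule order_tendstoD) simp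
  have e4: "eventually (\<lambda>n. 33 * ((1 + \<epsilon> / 2) * ln (real n) / real n) < 1) sequentially"
    using lim5 by (rule order_tendstoD) simp
  have bound: "eventually (\<lambda>n. bad n \<le> 576 / a n * c n ^ 32 * exp (- c n) + 8 * (c n)\<^sup>2 / real n +
      2 * ((96 * (c n)\<^sup>2) ^ 3 * exp (- 2 / 5 * c n)) + 800 / (\<epsilon> * l n)) sequentially"
    using e1 e2 e3 e4 eventually_ge_at_top[of 15] assms(3,5,7)
  proof eventually_elim
    case (elim n)
    have n: "n > 0" using elim by simp
    show ?case unfolding bad_def
    proof (rule prob_not_hamiltonian)
      show "a n * real n \<le> 1 \<or> (\<forall>v\<in>{1..n}. a n * real n \<le> real (degree (G n) v))"
      proof (cases "\<alpha> n \<le> 1 / real n")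
        case True
        then show ?thesis using n by (simp add: a_def)
      next
        case False
        then have "a n = \<alpha> n" by (simp add: a_def)
        then have "a n * real n \<le> real (degree (G n) v)" if "v \<in> {1..n}" for v
        proof -
          have "min_degree {1..n} (G n) \<le> degree (G n) v"
            unfolding min_degree_def using that by (intro Min_le) auto
          then show ?thesis using elim(7) \<open>a n = \<alpha> n\<close> by simp
        qed
        then show ?thesis by blast
      qed
      have "33 * (c n / real n) \<le> 33 * ((1 + \<epsilon> / 2) * ln (real n) / real n)"
        using c_le[OF n] n by (intro mult_left_mono divide_right_mono) auto
      then show "33 * (c n / real n) \<le> 1" using elim(4) by linarith
      have "l n \<le> ln (1 / \<alpha> n)"
        unfolding l_def using elim(6) a0[OF n] by (intro ln_mono divide_left_mono) (auto simp: a_def)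
      then have "(1 + \<epsilon>) * (l n / real n) \<le> (1 + \<epsilon>) * (ln (1 / \<alpha> n) / real n)"
        using assms(1) n by (intro mult_left_mono divide_right_mono) auto
      then show "(1 + \<epsilon>) * (l n / real n) \<le> p n" using elim(8) by linarith
      show "200 \<le> \<epsilon> * l n" using elim(2) assms(1) by (simp add: field_simps)
    qed (use elim assms(1,4,6) a0[OF n] c_def in auto)
  qed
  have "bad \<longlonglongrightarrow> 0"
  proof (rule tendsto_sandwich[OF _ bound tendsto_const])
    show "(\<lambda>n. 576 / a n * c n ^ 32 * exp (- c n) + 8 * (c n)\<^sup>2 / real n +
        2 * ((96 * (c n)\<^sup>2) ^ 3 * exp (- 2 / 5 * c n)) + 800 / (\<epsilon> * l n)) \<longlonglongrightarrow> 0"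
      using tendsto_add[OF tendsto_add[OF tendsto_add[OF lim1 lim2] tendsto_mult_left[OF lim3, of 2]] lim4]
      by simp
  qed (simp add: bad_def)
  then have "(\<lambda>n. 1 - bad n) \<longlonglongrightarrow> 1 - 0" by (intro tendsto_diff tendsto_const)
  moreover have "1 - bad n = measure_pmf.prob (gnp n (p n)) {R. hamiltonian {1..n} (G n \<union> R)}" for n
    using measure_pmf.prob_compl[of "{R. hamiltonian {1..n} (G n \<union> R)}" "gnp n (p n)"]
    by (simp add: bad_def Collect_neg_eq Compl_eq_Diff_UNIV)
  ultimately show ?thesis by simp
qed

end
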